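(* Let $\Sigma$ be a 2-dimensional $C^{1,1}$ smooth submanifold of the Engel group $\mathbb{E}$. Let $d$ be the degree of $\Sigma$ and let $\Sigma_d=\{x\in\Sigma: d_\Sigma(x)=d\}$ be the open subset of points of degree $d$. Then $$\mathcal{S}^d(\Sigma\setminus\Sigma_d)=0 .$$
   Context: Engel group: $\mathbb{E}=\mathbb{R}^4$ with the Lie group structure having identity $0$ for which the vector fields $X_1=\partial_1$, $X_2=\partial_2+x_1\partial_3+\frac{x_1^2}{2}\partial_4$, $X_3=\partial_3+x_1\partial_4$, $X_4=\partial_4$ form a basis of the left invariant vector fields (the only nontrivial brackets are $[X_1,X_2]=X_3$ and $[X_1,X_3]=X_4$). The dilations $\delta_r(x)=(rx_1,rx_2,r^2x_3,r^3x_4)$, $r>0$, are group automorphisms. Fix an arbitrary homogeneous distance $\rho$ on $\mathbb{R}^4$, that is, a continuous, left invariant distance with $\rho(\delta_rx,\delta_ry)=r\,\rho(x,y)$ for all $x,y$ and $r>0$. $\mathcal{S}^d$ is the $d$-dimensional spherical Hausdorff measure of $\rho$, built by Carath\'eodory's construction from coverings by closed $\rho$-balls $D_{x,r}$ with size function $\zeta_d(D_{x,r})=r^d$. Submanifolds are embedded, without boundary; $C^{1,1}$ means locally parametrized by $C^1$ immersions with locally Lipschitz first derivatives. Degree: set $d_1=d_2=1$, $d_3=2$, $d_4=3$. A nonzero 2-vector $\tau=\sum_{i<j}\tau_{ij}X_i\wedge X_j$ has degree $\max\{d_i+d_j:\tau_{ij}\ne0\}$. For a 2-dimensional submanifold $\Sigma$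 and $x\in\Sigma$, the pointwise degree $d_\Sigma(x)$ is the degree of a nonzero tangent 2-vector of $\Sigma$ at $x$ (the wedge product of a basis of $T_x\Sigma$), written in terms of the $X_i$'s evaluated at $x$. The degree of $\Sigma$ is $\max_{x\in\Sigma}d_\Sigma(x)$. *)

theory Defs
  imports "HOL-Analysis.Analysis"
begin

definition engel_X :: "4 \<Rightarrow> real^4 \<Rightarrow> real^4" where
  "engel_X i x =
    (if i = 1 then axis 1 1
     else if i = 2 then axis 2 1 + x$1 *\<^sub>R axis 3 1 + ((x$1)\<^sup>2 / 2) *\<^sub>R axis 4 1
     else if i = 3 then axis 3 1 + x$1 *\<^sub>R axis 4 1
     else axis 4 1)"

text \<open>
  The group law is determined by the vector fields: the left translation by \<open>p\<close> is the only
  differentiable map \<open>f\<close> with \<open>f 0 = p\<close> whose derivative at every \<open>q\<close> sends \<open>X\<^sub>i(q)\<close> to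
  \<open>X\<^sub>i(f q)\<close>. See \<open>engel_mult_left_invariant\<close> and \<open>engel_mult_unique\<close> below.
\<close>

definition engel_mult :: "real^4 \<Rightarrow> real^4 \<Rightarrow> real^4" where
  "engel_mult p q = (\<chi> i.
     if i = 1 then p$1 + q$1
     else if i = 2 then p$2 + q$2
     else if i = 3 then p$3 + q$3 + p$1 * q$2
     else p$4 + q$4 + p$1 * q$3 + (p$1)\<^sup>2 / 2 * q$2)"

lemma engel_mult_nth [simp]:
  "engel_mult p q $ 1 = p$1 + q$1"
  "engel_mult p q $ 2 = p$2 + q$2"
  "engel_mult p q $ 3 = p$3 + q$3 + p$1 * q$2"
  "engel_mult p q $ 4 = p$4 + q$4 + p$1 * q$3 + (p$1)\<^sup>2 / 2 * q$2"
  by (simp_all add: engel_mult_def)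

lemma engel_X_nth:
  "engel_X 1 x $ 1 = 1" "engel_X 1 x $ 2 = 0" "engel_X 1 x $ 3 = 0" "engel_X 1 x $ 4 = 0"
  "engel_X 2 x $ 1 = 0" "engel_X 2 x $ 2 = 1" "engel_X 2 x $ 3 = x$1" "engel_X 2 x $ 4 = (x$1)\<^sup>2 / 2"
  "engel_X 3 x $ 1 = 0" "engel_X 3 x $ 2 = 0" "engel_X 3 x $ 3 = 1" "engel_X 3 x $ 4 = x$1"
  "engel_X 4 x $ 1 = 0" "engel_X 4 x $ 2 = 0" "engel_X 4 x $ 3 = 0" "engel_X 4 x $ 4 = 1"
  by (simp_all add: engel_X_def axis_def)

lemma engel_mult_assoc: "engel_mult (engel_mult p q) s = engel_mult p (engel_mult q s)"
  by (simp add: vec_eq_iff forall_4 field_simps power2_eq_square)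

lemma engel_mult_0: "engel_mult 0 p = p" "engel_mult p 0 = p"
  by (simp_all add: vec_eq_iff forall_4)

lemma engel_mult_inverse: "\<exists>q. engel_mult p q = 0 \<and> engel_mult q p = 0"
  by (rule exI[of _ "vector [- p$1, - p$2, - p$3 + p$1 * p$2,
        - p$4 + p$1 * p$3 - (p$1)\<^sup>2 / 2 * p$2] :: real^4"])
     (simp add: vec_eq_iff forall_4 vector_def field_simps power2_eq_square)

lemma engel_mult_left_invariant:
  "\<exists>D. (engel_mult p has_derivative D) (at q) \<and>
       (\<forall>i. D (engel_X i q) = engel_X i (engel_mult p q))"
proof -
  define D :: "real^4 \<Rightarrow> real^4" where "D = (\<lambda>h. engel_mult p h - p)"
  have lin: "linear D"
    by (rule linearI)
       (simp_all add: D_def vec_eq_iff forall_4 field_simps)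
  then have "bounded_linear D"
    by (rule linear_linear[THEN iffD2])
  then have "((\<lambda>q. p + D q) has_derivative D) (at q)"
    by (auto intro!: derivative_eq_intros bounded_linear_imp_has_derivative)
  moreover have "(\<lambda>q. p + D q) = engel_mult p"
    by (simp add: D_def)
  moreover have "\<forall>i. D (engel_X i q) = engel_X i (engel_mult p q)"
    by (simp add: D_def vec_eq_iff forall_4 engel_X_nth field_simps power2_eq_square)
  ultimately show ?thesis
    by auto
qed

lemma engel_frame_expansion:
  "v = (\<Sum>i\<in>UNIV. a$i *\<^sub>R engel_X i x) \<longleftrightarrow>
     a$1 = v$1 \<and> a$2 = v$2 \<and> a$3 = v$3 - x$1 * v$2 \<and>
     a$4 = v$4 - x$1 * v$3 + (x$1)\<^sup>2 / 2 * v$2"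
proof -
  have "v = (\<Sum>i\<in>UNIV. a$i *\<^sub>R engel_X i x) \<longleftrightarrow>
      v$1 = a$1 \<and> v$2 = a$2 \<and> v$3 = a$2 * x$1 + a$3 \<and> v$4 = a$2 * ((x$1)\<^sup>2 / 2) + a$3 * x$1 + a$4"
    by (simp add: vec_eq_iff forall_4 sum_4 engel_X_nth)
  also have "\<dots> \<longleftrightarrow> a$1 = v$1 \<and> a$2 = v$2 \<and> a$3 = v$3 - x$1 * v$2 \<and>
      a$4 = v$4 - x$1 * v$3 + (x$1)\<^sup>2 / 2 * v$2"
  proof -
    have "a$2 * ((x$1)\<^sup>2 / 2) + (v$3 - x$1 * v$2) * x$1 + a$4
        = a$4 + x$1 * v$3 - (x$1)\<^sup>2 / 2 * v$2" if "a$2 = v$2"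
      using that by (simp add: algebra_simps power2_eq_square)
    moreover have "v$3 = a$2 * x$1 + a$3 \<longleftrightarrow> a$3 = v$3 - x$1 * v$2" if "a$2 = v$2"
      using that by (auto simp: mult.commute)
    ultimately show ?thesis
      by (smt (verit))
  qed
  finally show ?thesis .
qed

lemma engel_mult_unique:
  assumes f0: "f 0 = p"
    and der: "\<And>q. (f has_derivative D q) (at q)"
    and inv: "\<And>q i. D q (engel_X i q) = engel_X i (f q)"
  shows "f = engel_mult p"
proof -
  have "\<forall>q. \<exists>D. (engel_mult p has_derivative D) (at q) \<and>
      (\<forall>i. D (engel_X i q) = engel_X i (engel_mult p q))"
    by (intro allI engel_mult_left_invariant)
  from choice[OF this] obtain E where E: "\<And>q. (engel_mult p has_derivative E q) (at q)"
    and Einv: "\<And>q i. E q (engel_X i q) = engel_X i (engel_mult p q)"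
    by blast
  have step: "f q $ k = engel_mult p q $ k"
    if eq: "\<And>q i. engel_X i (f q) $ k = engel_X i (engel_mult p q) $ k" for q k
  proof -
    have zero: "D q h $ k - E q h $ k = 0" for q h
    proof -
      have lin: "linear (D q)" "linear (E q)"
        using der E by (auto intro: has_derivative_linear)
      define a :: "real^4" where "a = vector [h$1, h$2, h$3 - q$1 * h$2,
        h$4 - q$1 * h$3 + (q$1)\<^sup>2 / 2 * h$2]"
      have h: "h = (\<Sum>i\<in>UNIV. a$i *\<^sub>R engel_X i q)"
        unfolding engel_frame_expansion a_def by (simp add: vector_def)
      have "D q h $ k = (\<Sum>i\<in>UNIV. a$i * engel_X i (f q) $ k)"
        by (subst h) (simp add: linear_sum[OF lin(1)] linear_scale[OF lin(1)] inv)
      moreover have "E q h $ k = (\<Sum>i\<in>UNIV. a$i * engel_X i (engel_mult p q) $ k)"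
        by (subst h) (simp add: linear_sum[OF lin(2)] linear_scale[OF lin(2)] Einv)
      ultimately show ?thesis by (simp add: eq)
    qed
    have "((\<lambda>q. f q $ k - engel_mult p q $ k) has_derivative (\<lambda>h. D q h $ k - E q h $ k)) (at q)" for q
      using der[of q] E[of q]
      by (auto intro!: has_derivative_diff bounded_linear.has_derivative[OF bounded_linear_vec_nth])
    then have "((\<lambda>q. f q $ k - engel_mult p q $ k) has_derivative (\<lambda>h. 0)) (at q)" for q
      by (simp add: zero)
    then have "\<exists>c. \<forall>q. f q $ k - engel_mult p q $ k = c"
      using has_derivative_zero_constant[of UNIV "\<lambda>q. f q $ k - engel_mult p q $ k"] by auto
    then obtain c where c: "\<And>q. f q $ k - engel_mult p q $ k = c" by blast
    from c[of 0] have "c = 0" by (simp add: f0 engel_mult_0)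
    with c[of q] show ?thesis by simp
  qed
  have X1: "engel_X i x $ 1 = engel_X i y $ 1" for i x y
    by (simp add: engel_X_def axis_def)
  have X2: "engel_X i x $ 2 = engel_X i y $ 2" for i x y
    by (simp add: engel_X_def axis_def)
  have X34: "engel_X i x $ k = engel_X i y $ k" if "x $ 1 = y $ 1" for i x y k
    using that by (simp add: engel_X_def)
  have 1: "f q $ 1 = engel_mult p q $ 1" for q
    by (rule step) (rule X1)
  have 2: "f q $ 2 = engel_mult p q $ 2" for q
    by (rule step) (rule X2)
  have 3: "f q $ 3 = engel_mult p q $ 3" for q
    by (rule step) (rule X34[OF 1])
  have 4: "f q $ 4 = engel_mult p q $ 4" for q
    by (rule step) (rule X34[OF 1])
  show ?thesis
    by (intro ext, unfold vec_eq_iff forall_4) (intro conjI 1 2 3 4)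
qed

definition engel_weight :: "4 \<Rightarrow> nat" where
  "engel_weight i = (if i = 1 \<or> i = 2 then 1 else if i = 3 then 2 else 3)"

definition engel_dilation :: "real \<Rightarrow> real^4 \<Rightarrow> real^4" where
  "engel_dilation r x = (\<chi> i. r ^ engel_weight i * x$i)"

definition homogeneous_distance :: "(real^4 \<Rightarrow> real^4 \<Rightarrow> real) \<Rightarrow> bool" where
  "homogeneous_distance \<rho> \<longleftrightarrow>
     Metric_space UNIV \<rho> \<and>
     continuous_on UNIV (\<lambda>(x, y). \<rho> x y) \<and>
     (\<forall>p x y. \<rho> (engel_mult p x) (engel_mult p y) = \<rho> x y) \<and>
     (\<forall>r>0. \<forall>x y. \<rho> (engel_dilation r x) (engel_dilation r y) = r * \<rho> x y)"


definition dist_diameter :: "('a \<Rightarrow> 'a \<Rightarrow> real) \<Rightarrow> 'a set \<Rightarrow> ennreal" where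
  "dist_diameter \<rho> E = (SUP (y, z) \<in> E \<times> E. ennreal (\<rho> y z))"

text \<open>
  Countable families of balls are represented by countable sets of (centre, radius) pairs, so that
  finite (and empty) families are included.
\<close>

definition spherical_measure :: "('a \<Rightarrow> 'a \<Rightarrow> real) \<Rightarrow> nat \<Rightarrow> 'a set \<Rightarrow> ennreal" where
  "spherical_measure \<rho> d A =
     (SUP \<delta>\<in>{0::real<..}.
        INF G\<in>{G. countable G \<and>
                  (\<forall>(x, r)\<in>G. 0 < r \<and>
                     dist_diameter \<rho> (Metric_space.mcball UNIV \<rho> x r) \<le> ennreal \<delta>) \<and>
                  A \<subseteq> (\<Union>(x, r)\<in>G. Metric_space.mcball UNIV \<rho> x r)}.
          (\<Sum>\<^sub>\<infinity>(x, r)\<in>G. ennreal (r ^ d)))"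


text \<open>Local parametrizations of class \<open>C\<^sup>1\<^sup>,\<^sup>1\<close>; a locally Lipschitz derivative is continuous.\<close>

definition C11_parametrization ::
  "(real^4) set \<Rightarrow> (real^2) set \<Rightarrow> (real^2 \<Rightarrow> real^4) \<Rightarrow> bool" where
  "C11_parametrization S V \<phi> \<longleftrightarrow>
     open V \<and>
     openin (top_of_set S) (\<phi> ` V) \<and>
     (\<exists>\<psi>. homeomorphism V (\<phi> ` V) \<phi> \<psi>) \<and>
     (\<exists>\<phi>' :: real^2 \<Rightarrow> ((real^2) \<Rightarrow>\<^sub>L (real^4)).
        (\<forall>u\<in>V. (\<phi> has_derivative blinfun_apply (\<phi>' u)) (at u) \<and> inj (blinfun_apply (\<phi>' u))) \<and>
        (\<forall>u\<in>V. \<exists>e>0. \<exists>L. L-lipschitz_on (ball u e \<inter> V) \<phi>'))"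

definition C11_surface :: "(real^4) set \<Rightarrow> bool" where
  "C11_surface S \<longleftrightarrow> (\<forall>x\<in>S. \<exists>V \<phi>. C11_parametrization S V \<phi> \<and> x \<in> \<phi> ` V)"

definition tangent_space :: "(real^4) set \<Rightarrow> real^4 \<Rightarrow> (real^4) set" where
  "tangent_space S x =
     {v. \<exists>\<gamma> :: real \<Rightarrow> real^4. \<gamma> 0 = x \<and> (\<forall>\<^sub>F t in nhds 0. \<gamma> t \<in> S) \<and>
           (\<gamma> has_vector_derivative v) (at 0)}"

definition engel_coords :: "real^4 \<Rightarrow> real^4 \<Rightarrow> real^4" where
  "engel_coords x v = (THE a. v = (\<Sum>i\<in>UNIV. a$i *\<^sub>R engel_X i x))"

lemma engel_coords_expansion: "v = (\<Sum>i\<in>UNIV. engel_coords x v $ i *\<^sub>R engel_X i x)"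
proof -
  define a :: "real^4" where "a = vector [v$1, v$2, v$3 - x$1 * v$2,
        v$4 - x$1 * v$3 + (x$1)\<^sup>2 / 2 * v$2]"
  have "\<exists>!a. v = (\<Sum>i\<in>UNIV. a$i *\<^sub>R engel_X i x)"
  proof (rule ex1I[of _ a])
    show "v = (\<Sum>i\<in>UNIV. a$i *\<^sub>R engel_X i x)"
      unfolding engel_frame_expansion a_def by (simp add: vector_def)
  next
    fix b :: "real^4"
    assume "v = (\<Sum>i\<in>UNIV. b$i *\<^sub>R engel_X i x)"
    then show "b = a"
      unfolding engel_frame_expansion a_def by (simp add: vec_eq_iff forall_4 vector_def)
  qed
  then show ?thesis
    unfolding engel_coords_def by (rule theI')
qed

text \<open>
  By bilinearity, if \<open>v = \<Sum>\<^sub>i a\<^sub>i X\<^sub>i(x)\<close> and \<open>w = \<Sum>\<^sub>j b\<^sub>j X\<^sub>j(x)\<close>, then \<open>v \<and> w\<close> has coefficient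
  \<open>a\<^sub>i b\<^sub>j - a\<^sub>j b\<^sub>i\<close> at \<open>X\<^sub>i \<and> X\<^sub>j\<close>.
\<close>

definition wedge_coeff :: "real^4 \<Rightarrow> real^4 \<Rightarrow> real^4 \<Rightarrow> 4 \<Rightarrow> 4 \<Rightarrow> real" where
  "wedge_coeff x v w i j =
     engel_coords x v $ i * engel_coords x w $ j - engel_coords x v $ j * engel_coords x w $ i"

text \<open>
  The coefficients are antisymmetric in \<open>i, j\<close>, so the maximum need not be restricted to \<open>i < j\<close>
  (the order of the index type \<open>4\<close> is not the intended one, since there \<open>4 = 0\<close>).
\<close>

definition wedge_degree :: "real^4 \<Rightarrow> real^4 \<Rightarrow> real^4 \<Rightarrow> nat" where
  "wedge_degree x v w =
     Max {engel_weight i + engel_weight j | i j. wedge_coeff x v w i j \<noteq> 0}"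

text \<open>
  The tangent 2-vectors of two bases of \<open>T\<^sub>x S\<close> are nonzero multiples of each other,
  so the value does not depend on the basis.
\<close>

definition pointwise_degree :: "(real^4) set \<Rightarrow> real^4 \<Rightarrow> nat" where
  "pointwise_degree S x =
     (THE n. \<exists>v w. v \<noteq> w \<and> independent {v, w} \<and> span {v, w} = tangent_space S x \<and>
                   n = wedge_degree x v w)"

definition surface_degree :: "(real^4) set \<Rightarrow> nat" where
  "surface_degree S = Max (pointwise_degree S ` S)"

definition max_degree_points :: "(real^4) set \<Rightarrow> (real^4) set" where
  "max_degree_points S = {x \<in> S. pointwise_degree S x = surface_degree S}"

end

theory Submission
  imports Defs "HOL-Real_Asymp.Real_Asymp"
begin

text \<open>
  Let \<open>\<theta>\<^sub>3 = dx\<^sub>3 - x\<^sub>1 dx\<^sub>2\<close> and \<open>\<theta>\<^sub>4 =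
  dx\<^sub>4 - x\<^sub>1 dx\<^sub>3 + (x\<^sub>1\<^sup>2 / 2) dx\<^sub>2\<close> be the left invariant forms
  dual to \<open>X\<^sub>3\<close> and \<open>X\<^sub>4\<close>. On a tangent plane of the surface, the degree
  is at most 4 exactly when \<open>\<theta>\<^sub>3\<close> and \<open>\<theta>\<^sub>4\<close> are linearly
  dependent, at most 3 exactly when \<open>\<theta>\<^sub>4 = 0\<close>, and at most 2 exactly when
  \<open>\<theta>\<^sub>3 = \<theta>\<^sub>4 = 0\<close>. So if \<open>d\<close> is the degree of the surface,
  then in a local parametrization \<open>\<phi>\<close> the points of degree less than \<open>d\<close>
  correspond to the zeros \<open>N\<close> of a quantity built from the pulled back forms, which are Lipschitz
  in the parameter. The case \<open>d = 2\<close> is void, and the cases \<open>d = 3, 4, 5\<close> remain.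

  By left invariance and homogeneity, two points are at distance at most a constant times \<open>r\<close> when
  the coordinates of one relative to the other are at most \<open>r, r, r\<^sup>2, r\<^sup>3\<close>
  (\<open>homogeneous_distance_box_bound\<close>). Over a parameter square of side \<open>s\<close>, translate a
  point of the surface to the origin; the coordinates \<open>f\<^sub>3, f\<^sub>4\<close> of the translated map
  then decide how many balls are needed, and a covering of cost \<open>o(s\<^sup>2)\<close> per square makes the
  whole image negligible.

  For \<open>d = 5\<close>, the differentials of \<open>f\<^sub>3\<close> and \<open>f\<^sub>4\<close> at a
  point of \<open>N\<close> are multiples of one linear form, so \<open>(f\<^sub>3, f\<^sub>4)\<close> follows a
  line up to an error of order \<open>s\<^sup>2\<close>. Cutting the line into pieces of length
  \<open>r\<^sup>3\<close> takes about \<open>s / r\<^sup>3\<close> balls of radius \<open>r\<close>, at cost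
  \<open>s r\<^sup>2\<close>. The choice \<open>r\<^sup>2 = \<epsilon> s\<close> gives \<open>\<epsilon>
  s\<^sup>2\<close>, and the error of order \<open>s\<^sup>2\<close> is below \<open>r\<^sup>3\<close> as soon
  as \<open>s \<le> \<epsilon>\<^sup>3\<close> (\<open>has_small_covers_degree5\<close>).

  For \<open>d = 3\<close> and \<open>d = 4\<close> the balls have radius comparable to \<open>s\<close>, and
  squares that meet \<open>N\<close> cost at most a constant times \<open>s\<^sup>2\<close>. To gain a small
  factor, call a square good if \<open>N\<close> meets all its subsquares of side \<open>s / 2\<^sup>m\<close>.
  There \<open>\<theta>\<^sub>4\<close> is at most \<open>\<kappa> s\<close> with \<open>\<kappa>\<close> of
  order \<open>1 / 2\<^sup>m\<close>. If \<open>d = 3\<close>, the coordinate \<open>f\<^sub>4\<close> is at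
  most of order \<open>(\<kappa> + s) s\<^sup>2\<close>, and cutting its range into pieces of length
  \<open>s\<^sup>3\<close> costs only \<open>(\<kappa> + s) s\<^sup>2\<close>. If \<open>d = 4\<close>, then
  \<open>df\<^sub>4\<close> is close to \<open>f\<^sub>1 df\<^sub>3\<close>. As \<open>df\<^sub>4\<close> is
  closed, \<open>df\<^sub>1\<close> and \<open>df\<^sub>3\<close> must be almost dependent, which amounts to
  \<open>d\<theta>\<^sub>4 = - \<theta>\<^sub>1 \<and> \<theta>\<^sub>3\<close> and is read off by going round a
  triangle. Hence \<open>f\<^sub>4\<close> is, up to \<open>(\<kappa> + s) s\<^sup>2\<close>, a quadratic
  function of the linear part of \<open>f\<^sub>3\<close>, and the covering follows that curve at cost
  \<open>(\<kappa> + s) s\<^sup>2\<close> again.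

  The squares that meet \<open>N\<close> without being good contribute little for a combinatorial reason: the
  number of dyadic squares of side \<open>1 / 2\<^sup>k\<close> that meet \<open>N\<close>, divided by
  \<open>4\<^sup>k\<close>, decreases in \<open>k\<close> and so converges, while every square with a missing
  subsquare makes it drop by a fixed fraction of the area of that square (\<open>gap_cells_tendsto_0\<close>).
  This takes the place of Lebesgue's density theorem and of the differentiability almost everywhere of Lipschitz
  forms.
\<close>

section \<open>Null sets of the spherical measure\<close>

text \<open>
  Centres are recorded by parameters rather than by points, so that a cover is unaffected when
  \<open>\<phi>\<close> is composed with an isometry of \<open>\<rho>\<close>, in particular with a left
  translation.
\<close>

definition ball_cover :: "('b \<Rightarrow> 'b \<Rightarrow> real) \<Rightarrow> ('a \<Rightarrow> 'b) \<Rightarrow> 'a set \<Rightarrow> real \<Rightarrow> real \<Rightarrow> bool" where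
  "ball_cover \<rho> \<phi> Q n R \<longleftrightarrow>
     (\<exists>X. finite X \<and> real (card X) \<le> n \<and> (\<forall>u\<in>Q. \<exists>x\<in>X. \<rho> (\<phi> x) (\<phi> u) \<le> R))"

text \<open>
  All counting below goes through this pigeonhole form: parameters with equal index lie in one ball, centred at
  any one of them.
\<close>

lemma ball_cover_by_index:
  assumes T: "finite T" "real (card T) \<le> n" "g ` Q \<subseteq> T"
    and close: "\<And>u v. u \<in> Q \<Longrightarrow> v \<in> Q \<Longrightarrow> g u = g v \<Longrightarrow> \<rho> (\<phi> u) (\<phi> v) \<le> R"
  shows "ball_cover \<rho> \<phi> Q n R"
proof -
  have fin: "finite (g ` Q)"
    using T finite_subset by blast
  have "card (inv_into Q g ` g ` Q) \<le> card T"
    using card_image_le[OF fin] card_mono[OF T(1,3)] le_trans by blast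
  moreover have "\<exists>x \<in> inv_into Q g ` g ` Q. \<rho> (\<phi> x) (\<phi> u) \<le> R" if "u \<in> Q" for u
    using that close[of "inv_into Q g (g u)" u]
    by (auto simp: inv_into_into f_inv_into_f)
  ultimately show ?thesis
    unfolding ball_cover_def using T(2) fin
    by (intro exI[of _ "inv_into Q g ` g ` Q"]) auto
qed

lemma ball_cover_mono:
  "ball_cover \<rho> \<phi> Q n R \<Longrightarrow> n \<le> n' \<Longrightarrow> Q' \<subseteq> Q \<Longrightarrow> ball_cover \<rho> \<phi> Q' n' R"
  unfolding ball_cover_def by (meson order_trans subsetD)

lemma ball_cover_UN:
  assumes "finite I" "\<And>i. i \<in> I \<Longrightarrow> ball_cover \<rho> \<phi> (Q i) (n i) R"
  shows "ball_cover \<rho> \<phi> (\<Union>i\<in>I. Q i) (\<Sum>i\<in>I. n i) R"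
proof -
  obtain X where X: "\<And>i. i \<in> I \<Longrightarrow> finite (X i) \<and> real (card (X i)) \<le> n i \<and>
      (\<forall>u\<in>Q i. \<exists>x\<in>X i. \<rho> (\<phi> x) (\<phi> u) \<le> R)"
    using assms(2) unfolding ball_cover_def by metis
  have "real (card (\<Union>i\<in>I. X i)) \<le> (\<Sum>i\<in>I. real (card (X i)))"
    using card_UN_le[OF assms(1), of X] by (metis of_nat_le_iff of_nat_sum)
  also have "\<dots> \<le> (\<Sum>i\<in>I. n i)"
    using X by (intro sum_mono) auto
  finally show ?thesis
    unfolding ball_cover_def using X assms(1)
    by (intro exI[of _ "\<Union>i\<in>I. X i"]) (fastforce)
qed

text \<open>
  Null sets that already have finite covers by balls of one common small radius.
\<close>

definition has_small_covers :: "('a \<Rightarrow> 'a \<Rightarrow> real) \<Rightarrow> nat \<Rightarrow> 'a set \<Rightarrow> bool" where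
  "has_small_covers \<rho> d A \<longleftrightarrow>
     (\<forall>\<eta>>0. \<forall>\<delta>>0. \<exists>n R. 0 < R \<and> R \<le> \<delta> \<and> n * R ^ d \<le> \<eta> \<and> ball_cover \<rho> id A n R)"

lemma sum_UN_le:
  fixes f :: "'a \<Rightarrow> real"
  assumes "finite I" "\<And>i. i \<in> I \<Longrightarrow> finite (A i)" "\<And>i x. i \<in> I \<Longrightarrow> x \<in> A i \<Longrightarrow> 0 \<le> f x"
  shows "sum f (\<Union>i\<in>I. A i) \<le> (\<Sum>i\<in>I. sum f (A i))"
  using assms
proof (induction I)
  case (insert i I)
  have "sum f (A i \<union> (\<Union>i\<in>I. A i)) \<le> sum f (A i) + sum f (\<Union>i\<in>I. A i)"
    using insert.prems insert.hyps(1) by (subst sum.union_inter[symmetric]) (auto intro!: sum_nonneg)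
  moreover have "sum f (\<Union>i\<in>I. A i) \<le> (\<Sum>i\<in>I. sum f (A i))"
    using insert.prems by (intro insert.IH) auto
  ultimately show ?case using insert.hyps by simp
qed simp

text \<open>
  Covers of the pieces with costs \<open>\<eta> / 2, \<eta> / 4, \<dots>\<close> combine to a cover of cost at
  most \<open>\<eta>\<close>. A ball of radius \<open>r\<close> has diameter at most \<open>2 r\<close>, which
  is why radii up to \<open>\<delta> / 2\<close> are used.
\<close>

lemma spherical_measure_eq_0I:
  fixes \<rho> :: "'a \<Rightarrow> 'a \<Rightarrow> real"
  assumes \<rho>: "Metric_space UNIV \<rho>"
    and small: "\<And>n::nat. has_small_covers \<rho> d (A n)"
    and B: "B \<subseteq> (\<Union>n. A n)"
  shows "spherical_measure \<rho> d B = 0"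
proof -
  interpret Metric_space UNIV \<rho> by fact
  have *: "(INF G\<in>{G. countable G \<and>
                  (\<forall>(x, r)\<in>G. 0 < r \<and> dist_diameter \<rho> (mcball x r) \<le> ennreal \<delta>) \<and>
                  B \<subseteq> (\<Union>(x, r)\<in>G. mcball x r)}.
          (\<Sum>\<^sub>\<infinity>(x, r)\<in>G. ennreal (r ^ d))) \<le> 0 + ennreal \<eta>"
    if \<delta>: "\<delta> > 0" and \<eta>: "\<eta> > 0" for \<delta> \<eta>
  proof -
    define e where "e n = \<eta> * (1/2) ^ Suc n" for n
    have "\<forall>n. \<exists>G. finite G \<and> (\<forall>(x, r)\<in>G. 0 < r \<and> r \<le> \<delta> / 2) \<and>
        A n \<subseteq> (\<Union>(x, r)\<in>G. mcball x r) \<and> (\<Sum>(x, r)\<in>G. r ^ d) \<le> e n"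
    proof
      fix n
      have "e n > 0" using \<eta> by (simp add: e_def)
      then obtain N R where NR: "0 < R" "R \<le> \<delta> / 2" "N * R ^ d \<le> e n" "ball_cover \<rho> id (A n) N R"
        using small[of n] \<delta> unfolding has_small_covers_def by (meson half_gt_zero)
      then obtain X where X: "finite X" "real (card X) \<le> N" "\<And>u. u \<in> A n \<Longrightarrow> \<exists>x\<in>X. \<rho> x u \<le> R"
        unfolding ball_cover_def by auto
      have "(\<Sum>(x, r)\<in>X \<times> {R}. r ^ d) = real (card X) * R ^ d"
        using X(1) by (simp add: sum.cartesian_product[symmetric])
      also have "\<dots> \<le> e n"
        using X(2) NR by (smt (verit) mult_right_mono zero_less_power)
      finally have "(\<Sum>(x, r)\<in>X \<times> {R}. r ^ d) \<le> e n" .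
      with X NR(1,2) show "\<exists>G. finite G \<and> (\<forall>(x, r)\<in>G. 0 < r \<and> r \<le> \<delta> / 2) \<and>
        A n \<subseteq> (\<Union>(x, r)\<in>G. mcball x r) \<and> (\<Sum>(x, r)\<in>G. r ^ d) \<le> e n"
        by (intro exI[of _ "X \<times> {R}"]) (auto simp: mcball_def)
    qed
    then obtain G where G: "\<And>n. finite (G n)" "\<And>n x r. (x, r) \<in> G n \<Longrightarrow> 0 < r \<and> r \<le> \<delta> / 2"
        "\<And>n. A n \<subseteq> (\<Union>(x, r)\<in>G n. mcball x r)" "\<And>n. (\<Sum>(x, r)\<in>G n. r ^ d) \<le> e n"
      by (metis (mono_tags, lifting) case_prodD)
    let ?G = "\<Union>n. G n"
    have diam: "dist_diameter \<rho> (mcball x r) \<le> ennreal \<delta>" if "(x, r) \<in> ?G" for x r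
      unfolding dist_diameter_def
    proof (rule SUP_least, clarify)
      fix a b assume "a \<in> mcball x r" "b \<in> mcball x r"
      then have "\<rho> a b \<le> \<rho> x a + \<rho> x b" "\<rho> x a \<le> r" "\<rho> x b \<le> r"
        using triangle''[of a x b] commute[of x a] commute[of x b] by auto
      moreover obtain k where "(x, r) \<in> G k" using \<open>(x, r) \<in> ?G\<close> by blast
      ultimately show "ennreal (\<rho> a b) \<le> ennreal \<delta>"
        using G(2)[of x r k] by (intro ennreal_leI) linarith
    qed
    have "countable ?G"
      using G(1) by (auto intro: countable_finite)
    moreover have "B \<subseteq> (\<Union>(x, r)\<in>?G. mcball x r)"
    proof
      fix y assume "y \<in> B"
      then obtain k where "y \<in> A k" using B by blast
      with G(3)[of k] show "y \<in> (\<Union>(x, r)\<in>?G. mcball x r)" by blast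
    qed
    moreover have "\<forall>z\<in>?G. case z of (x, r) \<Rightarrow> 0 < r \<and> dist_diameter \<rho> (mcball x r) \<le> ennreal \<delta>"
      using G(2) diam by blast
    moreover have "(\<Sum>\<^sub>\<infinity>(x, r)\<in>?G. ennreal (r ^ d)) \<le> 0 + ennreal \<eta>"
    proof -
      have fin: "(\<Sum>(x, r)\<in>F. ennreal (r ^ d)) \<le> ennreal \<eta>" if F: "finite F" "F \<subseteq> ?G" for F
      proof -
        obtain K where K: "F \<subseteq> (\<Union>n<K. G n)"
        proof -
          obtain h where h: "\<And>x. x \<in> F \<Longrightarrow> x \<in> G (h x)"
            using F(2) by (meson UN_E subsetD)
          define I where "I = h ` F"
          have I: "finite I" "F \<subseteq> (\<Union>n\<in>I. G n)"
            using F(1) h by (auto simp: I_def)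
          obtain K where "I \<subseteq> {..<K}"
            using I(1) finite_nat_iff_bounded by blast
          then have "F \<subseteq> (\<Union>n<K. G n)"
            using I(2) by blast
          then show thesis by (rule that)
        qed
        have nn: "0 \<le> r ^ d" if "(x, r) \<in> G k" for x r k
          using G(2)[OF that] by simp
        have "(\<Sum>(x, r)\<in>F. r ^ d) \<le> (\<Sum>(x, r)\<in>(\<Union>n<K. G n). r ^ d)"
          using K G(1) nn by (intro sum_mono2) auto
        also have "\<dots> \<le> (\<Sum>n<K. \<Sum>(x, r)\<in>G n. r ^ d)"
          using G(1) nn by (intro sum_UN_le) auto
        also have "\<dots> \<le> (\<Sum>n<K. e n)"
          by (intro sum_mono G(4))
        also have "\<dots> = \<eta> * (1 - (1/2) ^ K)"
          by (induction K) (simp_all add: e_def field_simps)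
        also have "\<dots> \<le> \<eta>"
          using \<eta> by (simp add: mult_le_cancel_left1)
        finally have "(\<Sum>(x, r)\<in>F. r ^ d) \<le> \<eta>" .
        moreover have "(\<Sum>(x, r)\<in>F. ennreal (r ^ d)) = ennreal (\<Sum>(x, r)\<in>F. r ^ d)"
          using nn F(2) by (subst sum_ennreal[symmetric]) (auto intro!: sum.cong)
        ultimately show ?thesis by (simp add: ennreal_leI)
      qed
      have "(\<Sum>\<^sub>\<infinity>(x, r)\<in>?G. ennreal (r ^ d))
          = (SUP F\<in>{F. finite F \<and> F \<subseteq> ?G}. \<Sum>(x, r)\<in>F. ennreal (r ^ d))"
        by (rule nonneg_infsum_complete) simp
      then show ?thesis
        unfolding add_0 by (simp only:) (rule SUP_least, use fin in blast)
    qed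
    ultimately have "?G \<in> {G. countable G \<and>
          (\<forall>(x, r)\<in>G. 0 < r \<and> dist_diameter \<rho> (mcball x r) \<le> ennreal \<delta>) \<and>
          B \<subseteq> (\<Union>(x, r)\<in>G. mcball x r)}" "(\<Sum>\<^sub>\<infinity>(x, r)\<in>?G. ennreal (r ^ d)) \<le> 0 + ennreal \<eta>"
      by blast+
    then show ?thesis
      by (rule INF_lower2)
  qed
  show ?thesis
    unfolding spherical_measure_def le_zero_eq[symmetric]
    by (rule SUP_least, rule ennreal_le_epsilon, rule *) simp_all
qed

lemma ball_cover_image_id:
  assumes "ball_cover \<rho> \<phi> N n R"
  shows "ball_cover \<rho> id (\<phi> ` N) n R"
proof -
  obtain X where X: "finite X" "real (card X) \<le> n" "\<forall>u\<in>N. \<exists>x\<in>X. \<rho> (\<phi> x) (\<phi> u) \<le> R"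
    using assms unfolding ball_cover_def by blast
  have "card (\<phi> ` X) \<le> card X" by (rule card_image_le[OF X(1)])
  with X show ?thesis
    unfolding ball_cover_def by (intro exI[of _ "\<phi> ` X"]) auto
qed

lemma has_small_covers_subset:
  "has_small_covers \<rho> d A \<Longrightarrow> B \<subseteq> A \<Longrightarrow> has_small_covers \<rho> d B"
  unfolding has_small_covers_def by (meson ball_cover_mono order_refl)

lemma has_small_covers_empty: "has_small_covers \<rho> d {}"
  unfolding has_small_covers_def
proof (intro allI impI)
  fix \<eta> \<delta> :: real assume "\<eta> > 0" "\<delta> > 0"
  then have "0 < \<delta> \<and> \<delta> \<le> \<delta> \<and> 0 * \<delta> ^ d \<le> \<eta> \<and> ball_cover \<rho> id {} 0 \<delta>"
    by (auto simp: ball_cover_def intro!: exI[of _ "{}"])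
  then show "\<exists>n R. 0 < R \<and> R \<le> \<delta> \<and> n * R ^ d \<le> \<eta> \<and> ball_cover \<rho> id {} n R"
    by (intro exI)
qed

text \<open>
  By the Lindelof property, countably many of the neighbourhoods suffice.
\<close>

lemma spherical_measure_eq_0_if_locally_small:
  fixes S :: "(real^4) set"
  assumes hom: "homogeneous_distance \<rho>"
    and loc: "\<And>x. x \<in> S \<Longrightarrow> \<exists>W. openin (top_of_set S) W \<and> x \<in> W \<and> has_small_covers \<rho> d (W \<inter> A)"
    and A: "A \<subseteq> S"
  shows "spherical_measure \<rho> d A = 0"
proof -
  define F where "F = {W. openin (top_of_set S) W \<and> has_small_covers \<rho> d (W \<inter> A)}"
  obtain F' where F': "F' \<subseteq> F" "countable F'" "\<Union>F' = \<Union>F"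
    using Lindelof_openin[of F S] unfolding F_def by blast
  have cov: "A \<subseteq> \<Union>F'"
    unfolding F'(3) using loc A unfolding F_def by blast
  define g where "g n = from_nat_into (insert {} F') n \<inter> A" for n
  show ?thesis
  proof (rule spherical_measure_eq_0I)
    show "Metric_space UNIV \<rho>" using hom unfolding homogeneous_distance_def by blast
    show "has_small_covers \<rho> d (g n)" for n
      using from_nat_into[of "insert {} F'" n] F'(1) has_small_covers_empty[of \<rho> d] by (auto simp: g_def F_def)
    have "range (from_nat_into (insert {} F')) = insert {} F'"
      using F'(2) by (intro range_from_nat_into) auto
    then have "(\<Union>n. g n) = \<Union>(insert {} F') \<inter> A"
      unfolding g_def by (metis UN_extend_simps(4))
    then show "A \<subseteq> (\<Union>n. g n)"
      using cov by auto
  qed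
qed

section \<open>Dyadic squares and the gaps of a planar set\<close>

definition dyadic_cell :: "nat \<Rightarrow> real^2 \<Rightarrow> int \<times> int" where
  "dyadic_cell k u = (\<lfloor>2 ^ k * u$1\<rfloor>, \<lfloor>2 ^ k * u$2\<rfloor>)"

definition subcells :: "nat \<Rightarrow> int \<times> int \<Rightarrow> (int \<times> int) set" where
  "subcells m c = {fst c * 2 ^ m..<(fst c + 1) * 2 ^ m} \<times> {snd c * 2 ^ m..<(snd c + 1) * 2 ^ m}"

text \<open>
  In the remaining squares that meet \<open>N\<close>, every point has a point of \<open>N\<close> within
  distance \<open>2 / 2\<^bsup>k + m\<^esup>\<close>.
\<close>

definition gap_cells :: "(real^2) set \<Rightarrow> nat \<Rightarrow> nat \<Rightarrow> (int \<times> int) set" where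
  "gap_cells N m k = {c \<in> dyadic_cell k ` N. \<not> subcells m c \<subseteq> dyadic_cell (k + m) ` N}"

lemma floor_mult_power2:
  "c * 2 ^ m \<le> \<lfloor>2 ^ (k + m) * x\<rfloor> \<and> \<lfloor>2 ^ (k + m) * x\<rfloor> < (c + 1) * 2 ^ m \<longleftrightarrow> \<lfloor>2 ^ k * x :: real\<rfloor> = c"
proof -
  have 1: "c * 2 ^ m \<le> \<lfloor>2 ^ (k + m) * x\<rfloor> \<longleftrightarrow> of_int c \<le> 2 ^ k * x" for c
  proof -
    have "c * 2 ^ m \<le> \<lfloor>2 ^ (k + m) * x\<rfloor> \<longleftrightarrow> of_int c * 2 ^ m \<le> (2 ^ k * x) * 2 ^ m"
      by (simp add: le_floor_iff power_add mult_ac)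
    then show ?thesis by simp
  qed
  show ?thesis
    using 1[of c] 1[of "c + 1"] by (simp add: floor_eq_iff) linarith
qed

lemma dyadic_cell_in_subcells:
  "dyadic_cell (k + m) u \<in> subcells m c \<longleftrightarrow> dyadic_cell k u = c"
  using floor_mult_power2[of "fst c" m k "u$1"] floor_mult_power2[of "snd c" m k "u$2"]
  unfolding dyadic_cell_def subcells_def by (auto simp: mem_Times_iff)

lemma card_subcells: "card (subcells m c) = 4 ^ m" "finite (subcells m c)"
proof -
  have "nat ((a + 1) * 2 ^ m - a * 2 ^ m) = 2 ^ m" for a :: int
    by (simp add: algebra_simps nat_power_eq)
  moreover have "(4::nat) ^ m = 2 ^ m * 2 ^ m"
    by (simp add: power_mult_distrib[symmetric])
  ultimately show "card (subcells m c) = 4 ^ m"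
    unfolding subcells_def card_cartesian_product card_atLeastLessThan_int by (simp add: nat_power_eq)
qed (simp add: subcells_def)

lemma finite_dyadic_cells:
  assumes "bounded N"
  shows "finite (dyadic_cell k ` N)"
proof -
  obtain B where B: "\<And>u. u \<in> N \<Longrightarrow> norm u \<le> B"
    using assms bounded_iff by blast
  have "dyadic_cell k u \<in> {\<lfloor>- (2 ^ k * B)\<rfloor>..\<lfloor>2 ^ k * B\<rfloor>} \<times> {\<lfloor>- (2 ^ k * B)\<rfloor>..\<lfloor>2 ^ k * B\<rfloor>}" if "u \<in> N" for u
  proof -
    have "\<bar>u$i\<bar> \<le> B" for i
      using B[OF that] component_le_norm_cart order_trans by blast
    then have "\<bar>2 ^ k * u$i\<bar> \<le> 2 ^ k * B" for i
      by (simp add: abs_mult)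
    then have "- (2 ^ k * B) \<le> 2 ^ k * u$i" "2 ^ k * u$i \<le> 2 ^ k * B" for i
      by (simp_all add: abs_le_iff minus_le_iff)
    then show ?thesis
      unfolding dyadic_cell_def by (auto intro!: floor_mono)
  qed
  then show ?thesis
    by (meson finite_SigmaI finite_atLeastAtMost_int finite_subset image_subsetI)
qed

text \<open>
  A square has \<open>4\<^sup>m\<close> subsquares, and at least one of them is lost if the square has a gap.
\<close>

lemma card_dyadic_cells_refine:
  assumes "bounded N"
  shows "card (dyadic_cell (k + m) ` N) + card (gap_cells N m k) \<le> 4 ^ m * card (dyadic_cell k ` N)"
proof -
  let ?A = "dyadic_cell k ` N" and ?B = "dyadic_cell (k + m) ` N"
  have fin: "finite ?A" "finite ?B"
    using assms finite_dyadic_cells by auto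
  have gap: "gap_cells N m k \<subseteq> ?A"
    by (auto simp: gap_cells_def)
  have "?B \<subseteq> (\<Union>c\<in>?A. subcells m c \<inter> ?B)"
    using dyadic_cell_in_subcells by blast
  then have "card ?B \<le> card (\<Union>c\<in>?A. subcells m c \<inter> ?B)"
    using fin by (intro card_mono finite_UN_I finite_Int) auto
  also have "\<dots> \<le> (\<Sum>c\<in>?A. card (subcells m c \<inter> ?B))"
    by (rule card_UN_le[OF fin(1)])
  finally have "card ?B \<le> (\<Sum>c\<in>?A. card (subcells m c \<inter> ?B))" .
  moreover have "card (gap_cells N m k) = (\<Sum>c\<in>?A. if c \<in> gap_cells N m k then 1 else 0)"
    using fin gap by (simp add: sum.If_cases Int_absorb1)
  moreover have "(\<Sum>c\<in>?A. card (subcells m c \<inter> ?B)) + (\<Sum>c\<in>?A. if c \<in> gap_cells N m k then 1 else 0)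
      \<le> (\<Sum>c\<in>?A. 4 ^ m)"
    unfolding sum.distrib[symmetric]
  proof (rule sum_mono)
    fix c assume "c \<in> ?A"
    show "card (subcells m c \<inter> ?B) + (if c \<in> gap_cells N m k then 1 else 0) \<le> 4 ^ m"
    proof (cases "c \<in> gap_cells N m k")
      case True
      then have "subcells m c \<inter> ?B \<subset> subcells m c"
        by (auto simp: gap_cells_def)
      then have "card (subcells m c \<inter> ?B) < 4 ^ m"
        using psubset_card_mono[OF card_subcells(2)] by (metis card_subcells(1))
      with True show ?thesis by simp
    next
      case False
      have "card (subcells m c \<inter> ?B) \<le> 4 ^ m"
        using card_mono[OF card_subcells(2), of "subcells m c \<inter> ?B" m c] by (simp add: card_subcells)
      with False show ?thesis by simp
    qed
  qed
  ultimately show ?thesis by (simp add: mult.commute)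
qed

lemma card_dyadic_cells_bounded:
  assumes "bounded N"
  shows "card (dyadic_cell k ` N) / 4 ^ k \<le> card (dyadic_cell 0 ` N)"
proof -
  have "card (dyadic_cell (0 + k) ` N) \<le> 4 ^ k * card (dyadic_cell 0 ` N)"
    using card_dyadic_cells_refine[OF assms, of 0 k] by linarith
  then have "real (card (dyadic_cell k ` N)) \<le> 4 ^ k * real (card (dyadic_cell 0 ` N))"
    using of_nat_mono[of _ _, where 'a = real] by fastforce
  then show ?thesis by (simp add: divide_simps mult.commute)
qed

text \<open>
  With \<open>a\<^sub>k\<close> the normalised number of squares meeting \<open>N\<close>, the refinement
  inequality bounds the normalised number of gap squares by \<open>4\<^sup>m (a\<^sub>k - a\<^bsub>k +
  m\<^esub>)\<close>. The sequence \<open>a\<close> decreases, so the differences tend to 0.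
\<close>

lemma gap_cells_tendsto_0:
  assumes "bounded N"
  shows "(\<lambda>k. card (gap_cells N m k) / 4 ^ k) \<longlonglongrightarrow> 0"
proof -
  define a where "a k = card (dyadic_cell k ` N) / 4 ^ k" for k
  have ref: "card (gap_cells N m k) / 4 ^ k \<le> 4 ^ m * (a k - a (k + m))" for k m
  proof -
    have "real (card (dyadic_cell (k + m) ` N) + card (gap_cells N m k)) \<le> real (4 ^ m * card (dyadic_cell k ` N))"
      using card_dyadic_cells_refine[OF assms, of k m] by (rule of_nat_mono)
    then have "real (card (dyadic_cell (k + m) ` N)) + real (card (gap_cells N m k))
        \<le> 4 ^ m * real (card (dyadic_cell k ` N))"
      by simp
    then show ?thesis
      unfolding a_def by (simp add: power_add divide_simps) (simp add: algebra_simps)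
  qed
  have "a (Suc k) \<le> a k" for k
    using ref[where k = k and m = 1] order_trans[of 0 "card (gap_cells N 1 k) / 4 ^ k" "4 * (a k - a (Suc k))"]
    by simp
  then have "decseq a" by (rule decseq_SucI)
  moreover have "0 \<le> a k" for k by (simp add: a_def)
  ultimately obtain l where l: "a \<longlonglongrightarrow> l"
    using decseq_convergent[of a 0] by blast
  have "(\<lambda>k. 4 ^ m * (a k - a (k + m))) \<longlonglongrightarrow> 4 ^ m * (l - l)"
    by (intro tendsto_intros l LIMSEQ_ignore_initial_segment)
  then have "(\<lambda>k. 4 ^ m * (a k - a (k + m))) \<longlonglongrightarrow> 0" by simp
  then show ?thesis
    by (rule Lim_null_comparison[rotated]) (simp add: ref)
qed

lemma dyadic_cell_eq_imp_norm_le: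
  assumes "dyadic_cell k u = dyadic_cell k v"
  shows "norm (u - v) \<le> 2 / 2 ^ k"
proof -
  have "\<bar>u$i - v$i\<bar> \<le> 1 / 2 ^ k" if "i = 1 \<or> i = 2" for i
  proof -
    have "\<lfloor>2 ^ k * u$i\<rfloor> = \<lfloor>2 ^ k * v$i\<rfloor>"
      using assms that by (auto simp: dyadic_cell_def)
    then have "\<bar>2 ^ k * u$i - 2 ^ k * v$i\<bar> \<le> 1" by linarith
    then have "2 ^ k * \<bar>u$i - v$i\<bar> \<le> 1"
      by (metis abs_mult abs_numeral power_abs right_diff_distrib)
    then show ?thesis by (simp add: field_simps)
  qed
  then have "\<bar>u$1 - v$1\<bar> + \<bar>u$2 - v$2\<bar> \<le> 2 / 2 ^ k"
    by (metis add_mono_thms_linordered_semiring(1) add_divide_distrib one_add_one)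
  then show ?thesis
    using norm_le_l1_cart[of "u - v"] by (simp add: sum_2)
qed

lemma convex_dyadic_cell: "convex {u. dyadic_cell k u = c}"
proof -
  have "{u. dyadic_cell k u = c} = {u. (2 ^ k *\<^sub>R axis 1 1) \<bullet> u \<ge> of_int (fst c)} \<inter>
     {u. (2 ^ k *\<^sub>R axis 1 1) \<bullet> u < of_int (fst c) + 1} \<inter>
     {u. (2 ^ k *\<^sub>R axis 2 1) \<bullet> u \<ge> of_int (snd c)} \<inter>
     {u. (2 ^ k *\<^sub>R axis 2 1) \<bullet> u < of_int (snd c) + 1}"
    by (auto simp: dyadic_cell_def floor_eq_iff inner_axis' prod_eq_iff)
  then show ?thesis
    by (simp only:) (intro convex_Int convex_halfspace_ge convex_halfspace_lt)
qed

lemma dyadic_scale_squared: "(2 / 2 ^ k)\<^sup>2 = (4 / 4 ^ k :: real)"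
  by (simp add: power_divide power2_eq_square flip: power_mult_distrib)

text \<open>
  Gap squares may cost a large multiple \<open>K\<close> of their area, since their proportion tends to 0; only
  the squares without gaps need a cost that is small relative to their area, and their number is at most a fixed
  multiple of \<open>4\<^sup>k\<close>.
\<close>

lemma has_small_covers_by_cells:
  assumes N: "bounded N"
    and cells: "\<And>\<eta> \<delta>. \<eta> > 0 \<Longrightarrow> \<delta> > 0 \<Longrightarrow> \<exists>m k0 K R. \<forall>k\<ge>k0. 0 < R k \<and> R k \<le> \<delta> \<and>
      (\<forall>c\<in>dyadic_cell k ` N. \<exists>n. n * R k ^ d \<le> (if c \<in> gap_cells N m k then K else \<eta>) / 4 ^ k \<and>
         ball_cover \<rho> \<phi> (N \<inter> {u. dyadic_cell k u = c}) n (R k))"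
  shows "has_small_covers \<rho> d (\<phi> ` N)"
  unfolding has_small_covers_def
proof (intro allI impI)
  fix \<eta> \<delta> :: real assume \<eta>: "\<eta> > 0" and \<delta>: "\<delta> > 0"
  define a where "a = real (card (dyadic_cell 0 ` N)) + 1"
  have a: "a > 0" by (simp add: a_def add_nonneg_pos)
  then have "\<eta> / (2 * a) > 0" using \<eta> by simp
  from cells[OF this \<delta>] obtain m k0 K R where *: "\<forall>k\<ge>k0. 0 < R k \<and> R k \<le> \<delta> \<and>
      (\<forall>c\<in>dyadic_cell k ` N. \<exists>n. n * R k ^ d \<le> (if c \<in> gap_cells N m k then K else \<eta> / (2 * a)) / 4 ^ k \<and>
         ball_cover \<rho> \<phi> (N \<inter> {u. dyadic_cell k u = c}) n (R k))"
    by (elim exE)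
  then have R: "\<And>k. k \<ge> k0 \<Longrightarrow> 0 < R k \<and> R k \<le> \<delta>"
    and cov: "\<And>k. k \<ge> k0 \<Longrightarrow> \<forall>c\<in>dyadic_cell k ` N.
        \<exists>n. n * R k ^ d \<le> (if c \<in> gap_cells N m k then K else \<eta> / (2 * a)) / 4 ^ k \<and>
         ball_cover \<rho> \<phi> (N \<inter> {u. dyadic_cell k u = c}) n (R k)"
    by simp_all
  have "(\<lambda>k. K * (card (gap_cells N m k) / 4 ^ k)) \<longlonglongrightarrow> K * 0"
    by (intro tendsto_intros gap_cells_tendsto_0 N)
  then have "\<forall>\<^sub>F k in sequentially. K * (card (gap_cells N m k) / 4 ^ k) < \<eta> / 2"
    using \<eta> by (intro order_tendstoD(2)[where y = "K * 0"]) auto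
  then have "\<forall>\<^sub>F k in sequentially. K * (card (gap_cells N m k) / 4 ^ k) < \<eta> / 2 \<and> k \<ge> k0"
    by (intro eventually_conj eventually_ge_at_top)
  then obtain k where k: "K * (card (gap_cells N m k) / 4 ^ k) < \<eta> / 2" "k \<ge> k0"
    using eventually_happens'[OF sequentially_bot] by blast
  let ?A = "dyadic_cell k ` N"
  have fin: "finite ?A" by (rule finite_dyadic_cells[OF N])
  obtain n where n: "\<And>c. c \<in> ?A \<Longrightarrow> n c * R k ^ d \<le> (if c \<in> gap_cells N m k then K else \<eta> / (2 * a)) / 4 ^ k"
    "\<And>c. c \<in> ?A \<Longrightarrow> ball_cover \<rho> \<phi> (N \<inter> {u. dyadic_cell k u = c}) (n c) (R k)"
    using bchoice[OF cov[OF k(2)]] by blast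
  have "ball_cover \<rho> \<phi> (\<Union>c\<in>?A. N \<inter> {u. dyadic_cell k u = c}) (\<Sum>c\<in>?A. n c) (R k)"
    by (intro ball_cover_UN fin n)
  moreover have "(\<Union>c\<in>?A. N \<inter> {u. dyadic_cell k u = c}) = N" by auto
  ultimately have bc: "ball_cover \<rho> id (\<phi> ` N) (\<Sum>c\<in>?A. n c) (R k)"
    by (simp add: ball_cover_image_id)
  have gap: "gap_cells N m k \<subseteq> ?A" by (auto simp: gap_cells_def)
  have "(\<Sum>c\<in>?A. n c) * R k ^ d \<le> (\<Sum>c\<in>?A. (if c \<in> gap_cells N m k then K else \<eta> / (2 * a)) / 4 ^ k)"
    unfolding sum_distrib_right by (intro sum_mono n)
  also have "\<dots> \<le> (\<Sum>c\<in>?A. (if c \<in> gap_cells N m k then K / 4 ^ k else 0) + \<eta> / (2 * a) / 4 ^ k)"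
    using \<eta> a by (intro sum_mono) auto
  also have "\<dots> = K * (card (gap_cells N m k) / 4 ^ k) + \<eta> / (2 * a) * (card ?A / 4 ^ k)"
    using fin gap by (simp add: sum.distrib sum.If_cases Int_absorb1 mult.commute)
  also have "\<dots> \<le> \<eta> / 2 + \<eta> / (2 * a) * a"
  proof (intro add_mono mult_left_mono)
    show "card ?A / 4 ^ k \<le> a"
      using card_dyadic_cells_bounded[OF N, of k] by (simp add: a_def)
  qed (use k \<eta> a in auto)
  also have "\<dots> = \<eta>" using a by simp
  finally show "\<exists>n R. 0 < R \<and> R \<le> \<delta> \<and> n * R ^ d \<le> \<eta> \<and> ball_cover \<rho> id (\<phi> ` N) n R"
    using bc R[OF k(2)] by blast
qed

text \<open>
  A Lipschitz function \<open>h\<close> that vanishes on \<open>N\<close> is at most of order \<open>\<Lambda> /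
  2\<^sup>m\<close> times the side on the squares without gaps, and at most of order \<open>\<Lambda>\<close>
  times the side on all squares that meet \<open>N\<close>. Thus one covering estimate, linear in the bound
  \<open>\<kappa>\<close> for \<open>h\<close>, serves both kinds of squares.
\<close>

lemma has_small_covers_by_flat_cells:
  fixes h :: "real^2 \<Rightarrow> real^2"
  assumes N: "bounded N" and pos: "A > 0" "D \<ge> 0" "\<Lambda> \<ge> 0"
    and lip: "\<And>k u v. k \<ge> kmin \<Longrightarrow> v \<in> N \<Longrightarrow> dyadic_cell k u = dyadic_cell k v \<Longrightarrow> norm (h u) \<le> \<Lambda> * norm (u - v)"
    and cov: "\<And>k c \<kappa>. k \<ge> kmin \<Longrightarrow> c \<in> dyadic_cell k ` N \<Longrightarrow> 0 \<le> \<kappa> \<Longrightarrow>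
      (\<And>u. dyadic_cell k u = c \<Longrightarrow> norm (h u) \<le> \<kappa> * (2 / 2 ^ k)) \<Longrightarrow>
      \<exists>n. n * (A * (2 / 2 ^ k)) ^ d \<le> D * (\<kappa> + 2 / 2 ^ k) / 4 ^ k \<and>
        ball_cover \<rho> \<phi> (N \<inter> {u. dyadic_cell k u = c}) n (A * (2 / 2 ^ k))"
  shows "has_small_covers \<rho> d (\<phi> ` N)"
proof (rule has_small_covers_by_cells[OF N])
  fix \<eta> \<delta> :: real assume \<eta>: "\<eta> > 0" and \<delta>: "\<delta> > 0"
  have s0: "(\<lambda>k. 2 / 2 ^ k :: real) \<longlonglongrightarrow> 0"
    using LIMSEQ_power_zero[of "1/2 :: real"] tendsto_mult_right_zero[of "\<lambda>k. (1/2 :: real) ^ k" sequentially 2]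
    by (simp add: power_one_over)
  have "(\<lambda>m. D * (\<Lambda> * (2 / 2 ^ m))) \<longlonglongrightarrow> 0"
    by (intro tendsto_mult_right_zero s0)
  then have "\<forall>\<^sub>F m in sequentially. D * (\<Lambda> * (2 / 2 ^ m)) < \<eta> / 2"
    using \<eta> by (intro order_tendstoD(2)[where y = 0]) auto
  then obtain m where m: "D * (\<Lambda> * (2 / 2 ^ m)) < \<eta> / 2"
    using eventually_happens'[OF sequentially_bot] by blast
  have "\<forall>\<^sub>F k in sequentially. D * (2 / 2 ^ k) < \<eta> / 2"
    using \<eta> by (intro order_tendstoD(2)[where y = 0] tendsto_mult_right_zero s0) auto
  moreover have "\<forall>\<^sub>F k in sequentially. A * (2 / 2 ^ k) < \<delta>"
    using \<delta> by (intro order_tendstoD(2)[where y = 0] tendsto_mult_right_zero s0) auto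
  ultimately have "\<forall>\<^sub>F k in sequentially. D * (2 / 2 ^ k) < \<eta> / 2 \<and> A * (2 / 2 ^ k) < \<delta> \<and> k \<ge> kmin"
    by (intro eventually_conj eventually_ge_at_top)
  then obtain k0 where k0: "\<And>k. k \<ge> k0 \<Longrightarrow> D * (2 / 2 ^ k) < \<eta> / 2 \<and> A * (2 / 2 ^ k) < \<delta> \<and> k \<ge> kmin"
    unfolding eventually_sequentially by blast
  define R where "R k = A * (2 / 2 ^ k)" for k :: nat
  define K where "K = D * (\<Lambda> + 2)"
  have "\<exists>n. n * R k ^ d \<le> (if c \<in> gap_cells N m k then K else \<eta>) / 4 ^ k \<and>
         ball_cover \<rho> \<phi> (N \<inter> {u. dyadic_cell k u = c}) n (R k)"
    if k: "k \<ge> k0" and c: "c \<in> dyadic_cell k ` N" for k c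
  proof -
    have kmin: "k \<ge> kmin" using k0[OF k] by blast
    define \<kappa> where "\<kappa> = (if c \<in> gap_cells N m k then \<Lambda> else \<Lambda> / 2 ^ m)"
    have "norm (h u) \<le> \<kappa> * (2 / 2 ^ k)" if u: "dyadic_cell k u = c" for u
    proof (cases "c \<in> gap_cells N m k")
      case True
      obtain v where v: "v \<in> N" "dyadic_cell k v = c" using c by blast
      then have "norm (h u) \<le> \<Lambda> * norm (u - v)" using lip[OF kmin] u by simp
      also have "\<dots> \<le> \<Lambda> * (2 / 2 ^ k)"
        using u v pos by (intro mult_left_mono dyadic_cell_eq_imp_norm_le) auto
      finally show ?thesis using True by (simp add: \<kappa>_def)
    next
      case False
      then have "subcells m c \<subseteq> dyadic_cell (k + m) ` N"
        using c by (auto simp: gap_cells_def)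
      moreover have "dyadic_cell (k + m) u \<in> subcells m c"
        using u by (simp add: dyadic_cell_in_subcells)
      ultimately have "dyadic_cell (k + m) u \<in> dyadic_cell (k + m) ` N"
        by (rule subsetD)
      then obtain v where v: "v \<in> N" "dyadic_cell (k + m) u = dyadic_cell (k + m) v"
        by (rule imageE)
      then have "dyadic_cell k v = c"
        using u dyadic_cell_in_subcells[of k m v c] dyadic_cell_in_subcells[of k m u c] by simp
      then have "norm (h u) \<le> \<Lambda> * norm (u - v)" using lip[OF kmin v(1)] u by simp
      also have "\<dots> \<le> \<Lambda> * (2 / 2 ^ (k + m))"
        using v pos by (intro mult_left_mono dyadic_cell_eq_imp_norm_le) auto
      also have "\<dots> = \<kappa> * (2 / 2 ^ k)"
        using False by (simp add: \<kappa>_def power_add)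
      finally show ?thesis .
    qed
    moreover have \<kappa>: "0 \<le> \<kappa>" using pos by (simp add: \<kappa>_def)
    ultimately obtain n where n: "n * R k ^ d \<le> D * (\<kappa> + 2 / 2 ^ k) / 4 ^ k"
        "ball_cover \<rho> \<phi> (N \<inter> {u. dyadic_cell k u = c}) n (R k)"
      using cov[OF kmin c \<kappa>] unfolding R_def by blast
    have "D * (\<kappa> + 2 / 2 ^ k) \<le> (if c \<in> gap_cells N m k then K else \<eta>)"
    proof (cases "c \<in> gap_cells N m k")
      case True
      have "2 / 2 ^ k \<le> (2 :: real)" by (simp add: divide_le_eq)
      then show ?thesis using True pos by (simp add: \<kappa>_def K_def mult_left_mono)
    next
      case False
      have "D * (\<Lambda> / 2 ^ m) \<le> D * (\<Lambda> * (2 / 2 ^ m))"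
        using pos by (intro mult_left_mono) (auto simp: divide_simps)
      then have "D * (\<Lambda> / 2 ^ m) + D * (2 / 2 ^ k) \<le> \<eta>"
        using m k0[OF k] by linarith
      then show ?thesis using False by (simp add: \<kappa>_def distrib_left)
    qed
    then have "D * (\<kappa> + 2 / 2 ^ k) / 4 ^ k \<le> (if c \<in> gap_cells N m k then K else \<eta>) / 4 ^ k"
      by (rule divide_right_mono) simp
    with n show ?thesis using order_trans by blast
  qed
  then show "\<exists>m k0 K R. \<forall>k\<ge>k0. 0 < R k \<and> R k \<le> \<delta> \<and>
      (\<forall>c\<in>dyadic_cell k ` N. \<exists>n. n * R k ^ d \<le> (if c \<in> gap_cells N m k then K else \<eta>) / 4 ^ k \<and>
         ball_cover \<rho> \<phi> (N \<inter> {u. dyadic_cell k u = c}) n (R k))"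
    using pos k0 by (intro exI[of _ m] exI[of _ k0] exI[of _ K] exI[of _ R]) (auto simp: R_def less_imp_le)
qed

section \<open>The size of a ball of a homogeneous distance\<close>

text \<open>
  The differences are the coordinates of \<open>x\<inverse> y\<close> in the group, so the hypothesis says that
  \<open>x\<inverse> y\<close> lies in the homogeneous box of size \<open>r\<close>.
\<close>

definition box_bound :: "(real^4 \<Rightarrow> real^4 \<Rightarrow> real) \<Rightarrow> real \<Rightarrow> bool" where
  "box_bound \<rho> C \<longleftrightarrow> (\<forall>x y. \<forall>r>0. \<bar>y$1 - x$1\<bar> \<le> r \<longrightarrow> \<bar>y$2 - x$2\<bar> \<le> r \<longrightarrow>
     \<bar>y$3 - x$3 - x$1 * (y$2 - x$2)\<bar> \<le> r\<^sup>2 \<longrightarrow>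
     \<bar>y$4 - x$4 - x$1 * (y$3 - x$3) + (x$1)\<^sup>2 / 2 * (y$2 - x$2)\<bar> \<le> r ^ 3 \<longrightarrow> \<rho> x y \<le> C * r)"

lemma box_boundD:
  "box_bound \<rho> C \<Longrightarrow> 0 < r \<Longrightarrow> \<bar>y$1 - x$1\<bar> \<le> r \<Longrightarrow> \<bar>y$2 - x$2\<bar> \<le> r \<Longrightarrow>
     \<bar>y$3 - x$3 - x$1 * (y$2 - x$2)\<bar> \<le> r\<^sup>2 \<Longrightarrow>
     \<bar>y$4 - x$4 - x$1 * (y$3 - x$3) + (x$1)\<^sup>2 / 2 * (y$2 - x$2)\<bar> \<le> r ^ 3 \<Longrightarrow> \<rho> x y \<le> C * r"
  unfolding box_bound_def by blast

text \<open>
  After a left translation and a dilation the box has size 1, and there continuity bounds the distance from the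
  origin.
\<close>

lemma homogeneous_distance_box_bound:
  assumes "homogeneous_distance \<rho>"
  obtains C where "C \<ge> 1" "box_bound \<rho> C"
proof -
  have inv: "\<rho> (engel_mult p x) (engel_mult p y) = \<rho> x y" for p x y
    using assms unfolding homogeneous_distance_def by blast
  have dil: "\<rho> (engel_dilation r x) (engel_dilation r y) = r * \<rho> x y" if "r > 0" for r x y
    using assms that unfolding homogeneous_distance_def by blast
  have cont: "continuous_on UNIV (\<lambda>(x, y). \<rho> x y)"
    using assms unfolding homogeneous_distance_def by blast
  have "continuous_on UNIV ((\<lambda>(x, y). \<rho> x y) \<circ> (\<lambda>z. (0, z)))"
    by (intro continuous_on_compose continuous_intros continuous_on_subset[OF cont]) auto
  then have "continuous_on (cball 0 2) (\<lambda>z. \<rho> 0 z)"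
    by (auto simp: o_def intro: continuous_on_subset)
  then have "compact ((\<lambda>z. \<rho> 0 z) ` cball 0 2)"
    by (rule compact_continuous_image) simp
  then obtain C where C: "\<And>z. z \<in> cball 0 2 \<Longrightarrow> \<bar>\<rho> 0 z\<bar> \<le> C"
    using compact_imp_bounded bounded_iff by (metis image_eqI real_norm_def)
  have "\<rho> x y \<le> max 1 C * r"
    if r: "r > 0" and 1: "\<bar>y$1 - x$1\<bar> \<le> r" and 2: "\<bar>y$2 - x$2\<bar> \<le> r"
      and 3: "\<bar>y$3 - x$3 - x$1 * (y$2 - x$2)\<bar> \<le> r\<^sup>2"
      and 4: "\<bar>y$4 - x$4 - x$1 * (y$3 - x$3) + (x$1)\<^sup>2 / 2 * (y$2 - x$2)\<bar> \<le> r ^ 3" for x y r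
  proof -
    define z :: "real^4" where "z = vector [(y$1 - x$1) / r, (y$2 - x$2) / r,
      (y$3 - x$3 - x$1 * (y$2 - x$2)) / r\<^sup>2,
      (y$4 - x$4 - x$1 * (y$3 - x$3) + (x$1)\<^sup>2 / 2 * (y$2 - x$2)) / r ^ 3]"
    have z: "z$1 = (y$1 - x$1) / r" "z$2 = (y$2 - x$2) / r"
      "z$3 = (y$3 - x$3 - x$1 * (y$2 - x$2)) / r\<^sup>2"
      "z$4 = (y$4 - x$4 - x$1 * (y$3 - x$3) + (x$1)\<^sup>2 / 2 * (y$2 - x$2)) / r ^ 3"
      by (simp_all add: z_def vector_def)
    have "engel_mult x (engel_dilation r z) = y"
      using r by (simp add: vec_eq_iff forall_4 engel_dilation_def engel_weight_def z)
         (simp add: power2_eq_square algebra_simps)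
    moreover have "engel_mult x (engel_dilation r 0) = x"
      by (simp add: vec_eq_iff forall_4 engel_dilation_def)
    ultimately have "\<rho> x y = r * \<rho> 0 z"
      using inv[of x "engel_dilation r 0" "engel_dilation r z"] dil[OF r, of 0 z] by simp
    moreover have "\<bar>z$1\<bar> \<le> 1" "\<bar>z$2\<bar> \<le> 1" "\<bar>z$3\<bar> \<le> 1" "\<bar>z$4\<bar> \<le> 1"
      using r 1 2 3 4 by (simp_all add: z abs_divide)
    then have "(z$1)\<^sup>2 \<le> 1" "(z$2)\<^sup>2 \<le> 1" "(z$3)\<^sup>2 \<le> 1" "(z$4)\<^sup>2 \<le> 1"
      by (simp_all add: abs_square_le_1)
    then have "norm z \<le> 2"
      by (simp add: norm_vec_def L2_set_def sum_4 real_le_lsqrt)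
    then have "\<bar>\<rho> 0 z\<bar> \<le> C"
      using C by simp
    ultimately show ?thesis
      using r by (simp add: mult.commute)
  qed
  then have "box_bound \<rho> (max 1 C)"
    unfolding box_bound_def by blast
  then show thesis by (intro that[of "max 1 C"]) auto
qed

section \<open>Maps with bounded Lipschitz gradient and the invariant forms\<close>

lemma power_bounds_ge_1:
  assumes "(1::real) \<le> M"
  shows "0 \<le> M" "M \<le> M\<^sup>2" "M\<^sup>2 \<le> M ^ 3" "1 \<le> M\<^sup>2" "1 \<le> M ^ 3" "M \<le> M ^ 3"
proof -
  show 1: "0 \<le> M" "M \<le> M\<^sup>2" "M\<^sup>2 \<le> M ^ 3" "M \<le> M ^ 3"
    using assms power_increasing[of 1 2 M] power_increasing[of 2 3 M] power_increasing[of 1 3 M] by auto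
  show "1 \<le> M\<^sup>2" "1 \<le> M ^ 3" using 1 assms by linarith+
qed

lemma norm_triangle4:
  fixes a b c d :: "'a::real_normed_vector"
  assumes "norm a \<le> p" "norm b \<le> q" "norm c \<le> r" "norm d \<le> s"
  shows "norm (a + (b + (c - d))) \<le> p + (q + (r + s))"
  using assms norm_triangle_ineq[of a "b + (c - d)"] norm_triangle_ineq[of b "c - d"] norm_triangle_ineq4[of c d]
  by linarith

text \<open>
  One constant bounds both the gradients \<open>G i\<close> of the coordinates and their Lipschitz constants, so
  that all constants below are powers of \<open>M\<close>. The derivatives are taken within \<open>Q\<close>
  because \<open>Q\<close> will be a half open square.
\<close>

definition C11_bounded :: "real \<Rightarrow> (real^2) set \<Rightarrow> (real^2 \<Rightarrow> real^4) \<Rightarrow> (4 \<Rightarrow> real^2 \<Rightarrow> real^2) \<Rightarrow> bool" where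
  "C11_bounded M Q f G \<longleftrightarrow> convex Q \<and> 1 \<le> M \<and>
     (\<forall>i. \<forall>u\<in>Q. ((\<lambda>u. f u $ i) has_derivative (\<lambda>h. G i u \<bullet> h)) (at u within Q) \<and>
        norm (G i u) \<le> M \<and> (\<forall>v\<in>Q. norm (G i u - G i v) \<le> M * norm (u - v)))"

text \<open>
  The pull-backs by \<open>f\<close> of the left invariant forms dual to \<open>X\<^sub>3\<close> and
  \<open>X\<^sub>4\<close>, as vectors of coefficients.
\<close>

definition theta3 :: "(real^2 \<Rightarrow> real^4) \<Rightarrow> (4 \<Rightarrow> real^2 \<Rightarrow> real^2) \<Rightarrow> real^2 \<Rightarrow> real^2" where
  "theta3 f G u = G 3 u - f u $ 1 *\<^sub>R G 2 u"

definition theta4 :: "(real^2 \<Rightarrow> real^4) \<Rightarrow> (4 \<Rightarrow> real^2 \<Rightarrow> real^2) \<Rightarrow> real^2 \<Rightarrow> real^2" where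
  "theta4 f G u = G 4 u - f u $ 1 *\<^sub>R G 3 u + ((f u $ 1)\<^sup>2 / 2) *\<^sub>R G 2 u"

text \<open>
  Only the component of the gradient along the segment enters. The estimates in degree 4 depend on this, because
  a rotational term of the gradient is invisible on rays from the base point.
\<close>

lemma mvt_on_segment:
  fixes F :: "'a::real_inner \<Rightarrow> real"
  assumes Q: "convex Q" "u \<in> Q" "u + h \<in> Q"
    and der: "\<And>w. w \<in> Q \<Longrightarrow> (F has_derivative (\<lambda>k. H w \<bullet> k)) (at w within Q)"
    and bd: "\<And>t. 0 \<le> t \<Longrightarrow> t \<le> 1 \<Longrightarrow> \<bar>H (u + t *\<^sub>R h) \<bullet> h - c\<bar> \<le> E"
  shows "\<bar>F (u + h) - F u - c\<bar> \<le> E"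
proof -
  have mem: "u + t *\<^sub>R h \<in> Q" if "t \<in> {0..1}" for t
  proof -
    have "u + t *\<^sub>R h = (1 - t) *\<^sub>R u + t *\<^sub>R (u + h)" by (simp add: algebra_simps)
    then show ?thesis using Q that by (simp add: convexD_alt)
  qed
  have "((\<lambda>t. F (u + t *\<^sub>R h)) has_derivative (\<lambda>s. H (u + t *\<^sub>R h) \<bullet> (s *\<^sub>R h))) (at t within {0..1})"
    if "t \<in> {0..1}" for t
  proof (rule has_derivative_in_compose2[where t = Q and f = "\<lambda>t. u + t *\<^sub>R h" and g = F])
    show "((\<lambda>t. u + t *\<^sub>R h) has_derivative (\<lambda>s. s *\<^sub>R h)) (at t within {0..1})"
      by (auto intro!: derivative_eq_intros)
  qed (use der mem that in auto)
  then obtain t where "t \<in> {0<..<1::real}"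
      "F (u + 1 *\<^sub>R h) - F (u + 0 *\<^sub>R h) = H (u + t *\<^sub>R h) \<bullet> ((1 - 0) *\<^sub>R h)"
    using mvt_simple[of 0 1 "\<lambda>t. F (u + t *\<^sub>R h)" "\<lambda>t s. H (u + t *\<^sub>R h) \<bullet> (s *\<^sub>R h)"] by force
  then show ?thesis using bd[of t] by auto
qed

lemma inner_abs_le:
  assumes "norm v \<le> A" "norm w \<le> B"
  shows "\<bar>v \<bullet> w\<bar> \<le> A * B"
proof -
  have "\<bar>v \<bullet> w\<bar> \<le> norm v * norm w" by (rule Cauchy_Schwarz_ineq2)
  also have "\<dots> \<le> A * B" using assms norm_ge_zero order_trans by (intro mult_mono) blast+
  finally show ?thesis .
qed

lemma abs_mult_le:
  fixes a :: real
  shows "\<bar>a\<bar> \<le> A \<Longrightarrow> \<bar>b\<bar> \<le> B \<Longrightarrow> \<bar>a * b\<bar> \<le> A * B"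
  unfolding abs_mult by (intro mult_mono) auto

lemma norm_scaleR_le:
  assumes "\<bar>a\<bar> \<le> A" "norm v \<le> B"
  shows "norm (a *\<^sub>R v) \<le> A * B"
  using abs_mult_le[of a A "norm v" B] assms by simp

context
  fixes M Q f G and \<sigma> :: real
  assumes C11: "C11_bounded M Q f G"
begin

lemma C11_D:
  "convex Q" "1 \<le> M"
  "u \<in> Q \<Longrightarrow> ((\<lambda>u. f u $ i) has_derivative (\<lambda>h. G i u \<bullet> h)) (at u within Q)"
  "u \<in> Q \<Longrightarrow> norm (G i u) \<le> M"
  "u \<in> Q \<Longrightarrow> v \<in> Q \<Longrightarrow> norm (G i u - G i v) \<le> M * norm (u - v)"
  using C11 unfolding C11_bounded_def by blast+

lemma C11_segment:
  assumes "u \<in> Q" "v \<in> Q" "0 \<le> t" "t \<le> 1"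
  shows "u + t *\<^sub>R (v - u) \<in> Q"
proof -
  have "u + t *\<^sub>R (v - u) = (1 - t) *\<^sub>R u + t *\<^sub>R v" by (simp add: algebra_simps)
  then show ?thesis using C11_D(1) assms by (simp add: convexD_alt)
qed

lemma C11_increment_le:
  assumes uv: "u \<in> Q" "v \<in> Q" and bd: "\<And>w. w \<in> Q \<Longrightarrow> norm (G i w) \<le> K"
    and \<sigma>: "norm (v - u) \<le> \<sigma>"
  shows "\<bar>f v $ i - f u $ i\<bar> \<le> K * \<sigma>"
proof -
  have "\<bar>G i (u + t *\<^sub>R (v - u)) \<bullet> (v - u) - 0\<bar> \<le> K * \<sigma>" if "0 \<le> t" "t \<le> 1" for t
    using inner_abs_le[OF bd[OF C11_segment[OF uv that]] \<sigma>] by simp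
  from mvt_on_segment[of Q u "v - u" "\<lambda>u. f u $ i" "G i", OF C11_D(1) uv(1) _ C11_D(3) this] uv
  show ?thesis by simp
qed

lemma C11_taylor:
  assumes uv: "u \<in> Q" "v \<in> Q" and \<sigma>: "norm (v - u) \<le> \<sigma>"
  shows "\<bar>f v $ i - f u $ i - G i u \<bullet> (v - u)\<bar> \<le> M * \<sigma>\<^sup>2"
proof -
  have M: "0 \<le> M" using C11_D(2) by simp
  have "\<bar>G i (u + t *\<^sub>R (v - u)) \<bullet> (v - u) - G i u \<bullet> (v - u)\<bar> \<le> M * \<sigma>\<^sup>2" if "0 \<le> t" "t \<le> 1" for t
  proof -
    have "norm (G i (u + t *\<^sub>R (v - u)) - G i u) \<le> M * norm (u + t *\<^sub>R (v - u) - u)"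
      by (intro C11_D(5) C11_segment uv that)
    also have "\<dots> \<le> M * \<sigma>"
      using \<sigma> that M mult_mono[of "\<bar>t\<bar>" 1 "norm (v - u)" \<sigma>] by (intro mult_left_mono) auto
    finally have "norm (G i (u + t *\<^sub>R (v - u)) - G i u) \<le> M * \<sigma>" .
    from inner_abs_le[OF this \<sigma>] show ?thesis
      by (simp add: inner_diff_left power2_eq_square mult.assoc)
  qed
  from mvt_on_segment[of Q u "v - u" "\<lambda>u. f u $ i" "G i", OF C11_D(1) uv(1) _ C11_D(3) this] uv
  show ?thesis by simp
qed

end

text \<open>
  Left translation by \<open>q\<close> adds to each coordinate multiples of lower ones with coefficients at most
  \<open>\<bar>q\<^sub>1\<bar>\<close> and \<open>q\<^sub>1\<^sup>2\<close>, so the bounds grow by a factor of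
  at most \<open>3 M\<^sup>2\<close>, while the left invariant forms do not change.
\<close>

lemma C11_bounded_left_translate:
  assumes C11: "C11_bounded M B \<phi> G" and bd: "\<bar>q $ 1\<bar> \<le> M" and Q: "convex Q" "Q \<subseteq> B"
  obtains G' where "C11_bounded (3 * M ^ 3) Q (\<lambda>u. engel_mult q (\<phi> u)) G'"
    "\<And>u. theta3 (\<lambda>u. engel_mult q (\<phi> u)) G' u = theta3 \<phi> G u"
    "\<And>u. theta4 (\<lambda>u. engel_mult q (\<phi> u)) G' u = theta4 \<phi> G u"
proof
  define \<alpha> \<beta> :: "4 \<Rightarrow> real" where "\<alpha> i = (if i = 4 then q$1 else 0)"
    and "\<beta> i = (if i = 3 then q$1 else if i = 4 then (q$1)\<^sup>2 / 2 else 0)" for i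
  define G' where "G' i u = G i u + (\<alpha> i *\<^sub>R G 3 u + \<beta> i *\<^sub>R G 2 u)" for i u
  have f: "engel_mult q (\<phi> u) $ i = \<phi> u $ i + (\<alpha> i * \<phi> u $ 3 + \<beta> i * \<phi> u $ 2) + q $ i" for i u
    using forall_4[of "\<lambda>i. engel_mult q (\<phi> u) $ i = \<phi> u $ i + (\<alpha> i * \<phi> u $ 3 + \<beta> i * \<phi> u $ 2) + q $ i"]
    by (simp add: \<alpha>_def \<beta>_def)
  have M: "1 \<le> M" "0 \<le> M" "M \<le> M\<^sup>2" "M\<^sup>2 \<le> M ^ 3" "1 \<le> M ^ 3" "M \<le> M ^ 3"
    using C11_D(2)[OF C11] power_bounds_ge_1[of M] by auto
  have "(q$1)\<^sup>2 \<le> M\<^sup>2"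
    using bd by (metis abs_le_square_iff abs_of_nonneg M(2))
  then have \<alpha>\<beta>: "\<bar>\<alpha> i\<bar> \<le> M" "\<bar>\<beta> i\<bar> \<le> M\<^sup>2" for i
    using bd M by (auto simp: \<alpha>_def \<beta>_def)
  have combine: "norm (a + (\<alpha> i *\<^sub>R b + \<beta> i *\<^sub>R c)) \<le> 3 * M ^ 3 * x"
    if "norm a \<le> M * x" "norm b \<le> M * x" "norm c \<le> M * x" "0 \<le> x" for a b c :: "real^2" and i x
  proof -
    have "norm (a + (\<alpha> i *\<^sub>R b + \<beta> i *\<^sub>R c)) \<le> M * x + (M * (M * x) + M\<^sup>2 * (M * x))"
      by (intro norm_triangle_mono norm_scaleR_le \<alpha>\<beta> that)
    also have "\<dots> = (M + M\<^sup>2 + M ^ 3) * x"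
      by (simp add: power2_eq_square power3_eq_cube algebra_simps)
    also have "\<dots> \<le> 3 * M ^ 3 * x"
      using M that by (intro mult_right_mono) auto
    finally show ?thesis .
  qed
  show "C11_bounded (3 * M ^ 3) Q (\<lambda>u. engel_mult q (\<phi> u)) G'"
    unfolding C11_bounded_def
  proof (intro conjI allI ballI)
    show "convex Q" "1 \<le> 3 * M ^ 3" using Q M by auto
    fix i u assume "u \<in> Q"
    then have u: "u \<in> B" using Q by blast
    have der: "((\<lambda>u. \<phi> u $ j) has_derivative (\<lambda>h. G j u \<bullet> h)) (at u within Q)" for j
      by (rule has_derivative_subset[OF C11_D(3)[OF C11 u] Q(2)])
    show "((\<lambda>u. engel_mult q (\<phi> u) $ i) has_derivative (\<lambda>h. G' i u \<bullet> h)) (at u within Q)"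
      unfolding f by (rule derivative_eq_intros der refl | simp)+
        (simp add: G'_def fun_eq_iff inner_add_left)
    show "norm (G' i u) \<le> 3 * M ^ 3"
      unfolding G'_def using combine[where x = 1] C11_D(4)[OF C11 u] by simp
    fix v assume "v \<in> Q"
    then have v: "v \<in> B" using Q by blast
    have "G' i u - G' i v = (G i u - G i v) + (\<alpha> i *\<^sub>R (G 3 u - G 3 v) + \<beta> i *\<^sub>R (G 2 u - G 2 v))"
      by (simp add: G'_def algebra_simps)
    also have "norm \<dots> \<le> 3 * M ^ 3 * norm (u - v)"
      by (intro combine C11_D(5)[OF C11 u v] norm_ge_zero)
    finally show "norm (G' i u - G' i v) \<le> 3 * M ^ 3 * norm (u - v)" .
  qed
  show "theta3 (\<lambda>u. engel_mult q (\<phi> u)) G' u = theta3 \<phi> G u"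
    "theta4 (\<lambda>u. engel_mult q (\<phi> u)) G' u = theta4 \<phi> G u" for u
    by (simp_all add: theta3_def theta4_def G'_def \<alpha>_def \<beta>_def vec_eq_iff)
       (simp_all add: power2_eq_square field_simps)
qed

lemma theta4_lipschitz:
  assumes C11: "C11_bounded M B \<phi> G" and bd: "\<And>u. u \<in> B \<Longrightarrow> \<bar>\<phi> u $ 1\<bar> \<le> M"
    and u: "u \<in> B" and v: "v \<in> B"
  shows "norm (theta4 \<phi> G u - theta4 \<phi> G v) \<le> 5 * M ^ 3 * norm (u - v)"
proof -
  define x where "x = norm (u - v)"
  have M: "1 \<le> M" "0 \<le> M" "M \<le> M\<^sup>2" "M\<^sup>2 \<le> M ^ 3" "1 \<le> M ^ 3" "M \<le> M ^ 3"
    using C11_D(2)[OF C11] power_bounds_ge_1[of M] by auto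
  have x: "0 \<le> x" by (simp add: x_def)
  have G: "norm (G i u - G i v) \<le> M * x" for i
    unfolding x_def by (rule C11_D(5)[OF C11 u v])
  have \<phi>: "\<bar>\<phi> u $ 1 - \<phi> v $ 1\<bar> \<le> M * x"
    using C11_increment_le[OF C11 v u C11_D(4)[OF C11], of x 1] by (simp add: x_def)
  have sq: "\<bar>(\<phi> u $ 1)\<^sup>2 - (\<phi> v $ 1)\<^sup>2\<bar> \<le> (2 * M) * (M * x)"
  proof -
    have "\<bar>(\<phi> u $ 1 + \<phi> v $ 1) * (\<phi> u $ 1 - \<phi> v $ 1)\<bar> \<le> (2 * M) * (M * x)"
      using bd[OF u] bd[OF v] by (intro abs_mult_le \<phi>) linarith
    then show ?thesis by (simp add: power2_eq_square algebra_simps)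
  qed
  have s1: "\<bar>(\<phi> u $ 1)\<^sup>2 / 2\<bar> \<le> M\<^sup>2 / 2"
    using power_mono[OF bd[OF u], of 2] by simp
  have "theta4 \<phi> G u - theta4 \<phi> G v = (G 4 u - G 4 v) +
      (((\<phi> u $ 1)\<^sup>2 / 2) *\<^sub>R (G 2 u - G 2 v) + ((((\<phi> u $ 1)\<^sup>2 - (\<phi> v $ 1)\<^sup>2) / 2) *\<^sub>R G 2 v
      - (\<phi> u $ 1 *\<^sub>R (G 3 u - G 3 v) + (\<phi> u $ 1 - \<phi> v $ 1) *\<^sub>R G 3 v)))"
    by (simp add: theta4_def algebra_simps diff_divide_distrib)
  also have "norm \<dots> \<le> M * x + ((M\<^sup>2 / 2) * (M * x) + ((M * (M * x)) * M + (M * (M * x) + (M * x) * M)))"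
    using sq by (intro norm_triangle4 norm_triangle_mono norm_scaleR_le G s1 bd u \<phi> C11_D(4)[OF C11 v]) simp
  also have "\<dots> = (M + 2 * M\<^sup>2 + 3 / 2 * M ^ 3) * x"
    by (simp add: power2_eq_square power3_eq_cube algebra_simps)
  also have "\<dots> \<le> 5 * M ^ 3 * x"
    using M x by (intro mult_right_mono) auto
  finally show ?thesis by (simp add: x_def)
qed
section \<open>Counting balls over one square\<close>

lemma floor_index:
  fixes X :: real
  assumes "0 \<le> X"
  obtains T where "finite T" "real (card T) \<le> 2 * X + 2" "\<And>x. \<bar>x\<bar> \<le> X \<Longrightarrow> \<lfloor>x\<rfloor> \<in> T"
proof
  show "real (card {\<lfloor>- X\<rfloor>..\<lfloor>X\<rfloor>}) \<le> 2 * X + 2"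
    using assms by simp linarith
  show "\<lfloor>x\<rfloor> \<in> {\<lfloor>- X\<rfloor>..\<lfloor>X\<rfloor>}" if "\<bar>x\<bar> \<le> X" for x
    using that by (auto intro!: floor_mono simp: abs_le_iff)
qed simp

lemma floor_eq_imp_close: "\<lfloor>x\<rfloor> = \<lfloor>y\<rfloor> \<Longrightarrow> \<bar>x - y :: real\<bar> \<le> 1"
  by linarith

lemma floor_div_eq_imp_close:
  assumes "\<lfloor>x / s\<rfloor> = \<lfloor>y / s\<rfloor>" "0 < s"
  shows "\<bar>x - y :: real\<bar> \<le> s"
  using floor_eq_imp_close[OF assms(1)] assms(2)
  by (simp add: diff_divide_distrib[symmetric] abs_divide)

lemma parallel_vectors:
  fixes v w :: "real^2"
  assumes "v$1 * w$2 = v$2 * w$1"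
  obtains l b c where "norm l = 1" "v = b *\<^sub>R l" "w = c *\<^sub>R l"
proof (cases "v = 0")
  case True
  show thesis
  proof (cases "w = 0")
    case True
    with \<open>v = 0\<close> show thesis by (intro that[of "axis 1 1" 0 0]) (auto simp: norm_axis_1)
  next
    case False
    with \<open>v = 0\<close> show thesis by (intro that[of "sgn w" 0 "norm w"]) (auto simp: norm_sgn sgn_div_norm)
  qed
next
  case False
  then have "v$1 \<noteq> 0 \<or> v$2 \<noteq> 0" by (auto simp: vec_eq_iff forall_2)
  then obtain k where "w = k *\<^sub>R v"
  proof
    assume "v$1 \<noteq> 0"
    then show thesis using assms by (intro that[of "w$1 / v$1"]) (auto simp: vec_eq_iff forall_2 field_simps)
  next
    assume "v$2 \<noteq> 0"
    then show thesis using assms by (intro that[of "w$2 / v$2"]) (auto simp: vec_eq_iff forall_2 field_simps)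
  qed
  then show thesis using False
    by (intro that[of "sgn v" "norm v" "k * norm v"]) (auto simp: norm_sgn sgn_div_norm)
qed

context
  fixes \<rho> M Q f G C and \<sigma> :: real and u0 :: "real^2"
  assumes C11: "C11_bounded M Q f G" and box: "box_bound \<rho> C"
    and u0: "u0 \<in> Q" "f u0 = 0"
    and \<sigma>: "0 < \<sigma>" "\<sigma> \<le> 1" and diam: "\<And>u v. u \<in> Q \<Longrightarrow> v \<in> Q \<Longrightarrow> norm (u - v) \<le> \<sigma>"
begin

lemma const_ge_1: "1 \<le> M" "0 \<le> M" "M \<le> M\<^sup>2" "M\<^sup>2 \<le> M ^ 3" "1 \<le> M\<^sup>2" "1 \<le> M ^ 3" "M \<le> M ^ 3"
  using C11_D(2)[OF C11] power_bounds_ge_1[of M] by auto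

lemma increment_le_diam: "u \<in> Q \<Longrightarrow> v \<in> Q \<Longrightarrow> \<bar>f v $ i - f u $ i\<bar> \<le> M * \<sigma>"
  by (rule C11_increment_le[OF C11 _ _ C11_D(4)[OF C11] diam])

lemma coordinate_le_diam: "u \<in> Q \<Longrightarrow> \<bar>f u $ i\<bar> \<le> M * \<sigma>"
  using increment_le_diam[OF u0(1), of u i] u0(2) by simp

lemma theta_at_base_point: "theta3 f G u0 = G 3 u0" "theta4 f G u0 = G 4 u0"
  by (simp_all add: theta3_def theta4_def u0)

text \<open>
  At the base point the gradients of \<open>f\<^sub>3\<close> and \<open>f\<^sub>4\<close> are multiples of one
  unit vector \<open>l\<close>. Parameters in a strip of width \<open>r\<^sup>3\<close> orthogonal to
  \<open>l\<close> have \<open>f\<^sub>3\<close> and \<open>f\<^sub>4\<close> within a constant times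
  \<open>r\<^sup>3 + \<sigma>\<^sup>2\<close>, and \<open>\<sigma>\<^sup>2 \<le> r\<^sup>3\<close>; the strip
  therefore maps into one ball.
\<close>

lemma cover_degree5:
  assumes par: "theta3 f G u0 $ 1 * theta4 f G u0 $ 2 = theta3 f G u0 $ 2 * theta4 f G u0 $ 1"
    and r: "0 < r" "r \<le> 1" "\<sigma>\<^sup>2 \<le> r ^ 3"
  shows "ball_cover \<rho> f Q (2 * (\<sigma> / r ^ 3) + 2) (C * (4 * M * r))"
proof -
  obtain l b c where l: "norm l = 1" and b: "G 3 u0 = b *\<^sub>R l" and c: "G 4 u0 = c *\<^sub>R l"
    using parallel_vectors[OF par] unfolding theta_at_base_point by blast
  have bc: "\<bar>b\<bar> \<le> M" "\<bar>c\<bar> \<le> M"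
    using C11_D(4)[OF C11 u0(1), of 3] C11_D(4)[OF C11 u0(1), of 4] l by (simp_all add: b c)
  define t where "t u = l \<bullet> (u - u0)" for u
  have r3: "r ^ 3 \<le> r\<^sup>2" "0 < r ^ 3" using r by (simp_all add: power_decreasing)
  then have "\<sigma>\<^sup>2 \<le> r\<^sup>2" using r by linarith
  then have \<sigma>r: "\<sigma> \<le> r" by (rule power2_le_imp_le) (use r in simp)
  have tb: "\<bar>t u\<bar> \<le> \<sigma>" if "u \<in> Q" for u
    using inner_abs_le[of l 1 "u - u0" \<sigma>] l diam[OF that u0(1)] by (simp add: t_def)
  have "0 \<le> \<sigma> / r ^ 3" using \<sigma> r by simp
  then obtain T where T: "finite T" "real (card T) \<le> 2 * (\<sigma> / r ^ 3) + 2"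
      "\<And>x. \<bar>x\<bar> \<le> \<sigma> / r ^ 3 \<Longrightarrow> \<lfloor>x\<rfloor> \<in> T"
    using floor_index by blast
  show ?thesis
  proof (rule ball_cover_by_index[OF T(1,2)])
    show "(\<lambda>u. \<lfloor>t u / r ^ 3\<rfloor>) ` Q \<subseteq> T"
      using tb r3 by (auto intro!: T(3) simp: abs_divide divide_right_mono)
    fix u v assume uv: "u \<in> Q" "v \<in> Q" and eq: "\<lfloor>t u / r ^ 3\<rfloor> = \<lfloor>t v / r ^ 3\<rfloor>"
    have tt: "\<bar>t v - t u\<bar> \<le> r ^ 3"
      using floor_div_eq_imp_close[OF eq r3(2)] by linarith
    have d: "\<bar>f v $ i - f u $ i\<bar> \<le> 3 * (M * r ^ 3)" if "G i u0 = a *\<^sub>R l" "\<bar>a\<bar> \<le> M" for i a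
    proof -
      have "\<bar>f w $ i - a * t w\<bar> \<le> M * r ^ 3" if "w \<in> Q" for w
        using C11_taylor[OF C11 u0(1) that diam[OF that u0(1)], of i] u0(2) \<open>G i u0 = a *\<^sub>R l\<close>
          mult_left_mono[OF r(3) const_ge_1(2)] by (simp add: t_def)
      from this[OF uv(1)] this[OF uv(2)] have "\<bar>f v $ i - f u $ i - a * (t v - t u)\<bar> \<le> 2 * (M * r ^ 3)"
        by (simp add: right_diff_distrib)
      moreover have "\<bar>a * (t v - t u)\<bar> \<le> M * r ^ 3"
        by (rule abs_mult_le[OF that(2) tt])
      ultimately show ?thesis by linarith
    qed
    have \<sigma>M: "(M * \<sigma>) * (M * \<sigma>) \<le> M\<^sup>2 * r ^ 3"
      using mult_left_mono[OF r(3), of "M\<^sup>2"] by (simp add: power2_eq_square mult_ac)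
    have e12: "\<bar>f u $ 1 * (f v $ i - f u $ i)\<bar> \<le> M\<^sup>2 * r ^ 3" for i
      using abs_mult_le[OF coordinate_le_diam[OF uv(1), of 1] increment_le_diam[OF uv, of i]] \<sigma>M by linarith
    have e4: "\<bar>(f u $ 1)\<^sup>2 / 2 * (f v $ 2 - f u $ 2)\<bar> \<le> M ^ 3 * r ^ 3"
    proof -
      have "\<bar>f u $ 1\<bar> \<le> M"
        using coordinate_le_diam[OF uv(1), of 1] mult_left_mono[OF \<sigma>(2) const_ge_1(2)] by linarith
      from abs_mult_le[OF this e12[of 2]]
      have "\<bar>(f u $ 1)\<^sup>2 * (f v $ 2 - f u $ 2)\<bar> \<le> M ^ 3 * r ^ 3"
        by (simp add: power2_eq_square power3_eq_cube mult_ac)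
      then show ?thesis unfolding times_divide_eq_left by linarith
    qed
    have M3: "M * r ^ 3 \<le> M ^ 3 * r ^ 3" "M\<^sup>2 * r ^ 3 \<le> M ^ 3 * r ^ 3"
        "M * r ^ 3 \<le> M\<^sup>2 * r ^ 3" "M\<^sup>2 * r ^ 3 \<le> M\<^sup>2 * r\<^sup>2" "0 \<le> M ^ 3 * r ^ 3" "0 \<le> M\<^sup>2 * r\<^sup>2"
      using const_ge_1 r3 by (auto intro!: mult_right_mono mult_left_mono)
    have "M * \<sigma> \<le> 4 * M * r"
      using mult_mono[of M "4 * M" \<sigma> r] \<sigma>r const_ge_1 \<sigma> by auto
    show "\<rho> (f u) (f v) \<le> C * (4 * M * r)"
    proof (rule box_boundD[OF box])
      show "0 < 4 * M * r" using const_ge_1 r by simp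
      show "\<bar>f v $ 1 - f u $ 1\<bar> \<le> 4 * M * r" "\<bar>f v $ 2 - f u $ 2\<bar> \<le> 4 * M * r"
        using increment_le_diam[OF uv] \<open>M * \<sigma> \<le> 4 * M * r\<close> order_trans by blast+
      have "\<bar>f v $ 3 - f u $ 3 - f u $ 1 * (f v $ 2 - f u $ 2)\<bar> \<le> 16 * (M\<^sup>2 * r\<^sup>2)"
        using d[OF b bc(1)] e12[of 2] M3 by linarith
      then show "\<bar>f v $ 3 - f u $ 3 - f u $ 1 * (f v $ 2 - f u $ 2)\<bar> \<le> (4 * M * r)\<^sup>2"
        by (simp add: power_mult_distrib)
      have "\<bar>f v $ 4 - f u $ 4 - f u $ 1 * (f v $ 3 - f u $ 3) + (f u $ 1)\<^sup>2 / 2 * (f v $ 2 - f u $ 2)\<bar>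
          \<le> 64 * (M ^ 3 * r ^ 3)"
        using d[OF c bc(2)] e12[of 3] e4 M3 by linarith
      then show "\<bar>f v $ 4 - f u $ 4 - f u $ 1 * (f v $ 3 - f u $ 3) + (f u $ 1)\<^sup>2 / 2 * (f v $ 2 - f u $ 2)\<bar>
          \<le> (4 * M * r) ^ 3"
        by (simp add: power_mult_distrib)
    qed
  qed
qed

text \<open>
  Since \<open>\<theta>\<^sub>3\<close> vanishes somewhere in the square, the gradient of
  \<open>f\<^sub>3\<close> is of order \<open>\<sigma>\<close>, and then that of \<open>f\<^sub>4\<close> is of
  order \<open>\<kappa> \<sigma> + \<sigma>\<^sup>2\<close>. So \<open>f\<^sub>3\<close> already has the size
  allowed by a ball of radius comparable to \<open>\<sigma>\<close>, and only the range of
  \<open>f\<^sub>4\<close> has to be cut into pieces of length \<open>\<sigma>\<^sup>3\<close>.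
\<close>

lemma cover_degree3:
  assumes \<kappa>: "0 \<le> \<kappa>" and th4: "\<And>u. u \<in> Q \<Longrightarrow> norm (theta4 f G u) \<le> \<kappa> * \<sigma>"
    and z: "z \<in> Q" "theta3 f G z = 0"
  shows "ball_cover \<rho> f Q (2 * (\<kappa> / \<sigma> + 5 * M ^ 3) + 2) (C * (4 * M * \<sigma>))"
proof -
  have G3: "norm (G 3 u) \<le> 4 * M\<^sup>2 * \<sigma>" if u: "u \<in> Q" for u
  proof -
    have "G 3 u = (G 3 u - G 3 z) + (f z $ 1 *\<^sub>R G 2 z)"
      using z(2) by (simp add: theta3_def)
    also have "norm \<dots> \<le> M * \<sigma> + (M * \<sigma>) * M"
      using C11_D(5)[OF C11 u z(1), of 3] mult_left_mono[OF diam[OF u z(1)] const_ge_1(2)]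
      by (intro norm_triangle_le add_mono norm_scaleR_le coordinate_le_diam z C11_D(4)[OF C11]) auto
    also have "\<dots> \<le> 4 * M\<^sup>2 * \<sigma>"
    proof -
      have "M * \<sigma> \<le> M\<^sup>2 * \<sigma>" "0 \<le> M\<^sup>2 * \<sigma>" using const_ge_1 \<sigma> by (simp_all add: mult_right_mono)
      then show ?thesis by (simp add: power2_eq_square algebra_simps)
    qed
    finally show ?thesis .
  qed
  have G4: "norm (G 4 u) \<le> \<kappa> * \<sigma> + 5 * M ^ 3 * \<sigma>\<^sup>2" if u: "u \<in> Q" for u
  proof -
    have "G 4 u = theta4 f G u + (f u $ 1 *\<^sub>R G 3 u - ((f u $ 1)\<^sup>2 / 2) *\<^sub>R G 2 u)"
      by (simp add: theta4_def)
    also have "norm \<dots> \<le> \<kappa> * \<sigma> + ((M * \<sigma>) * (4 * M\<^sup>2 * \<sigma>) + ((M * \<sigma>)\<^sup>2 / 2) * M)"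
    proof (intro norm_triangle_le add_mono th4 u order_trans[OF norm_triangle_ineq4] norm_scaleR_le coordinate_le_diam G3 C11_D(4)[OF C11])
      show "\<bar>(f u $ 1)\<^sup>2 / 2\<bar> \<le> (M * \<sigma>)\<^sup>2 / 2"
        using coordinate_le_diam[OF u, of 1] power_mono[of "\<bar>f u $ 1\<bar>" "M * \<sigma>" 2] by simp
    qed
    also have "\<dots> \<le> \<kappa> * \<sigma> + 5 * M ^ 3 * \<sigma>\<^sup>2"
      using const_ge_1 \<sigma> by (simp add: power2_eq_square power3_eq_cube)
    finally show ?thesis .
  qed
  define X where "X = \<kappa> / \<sigma> + 5 * M ^ 3"
  have X: "0 \<le> X" using \<kappa> \<sigma> const_ge_1 by (simp add: X_def)
  have f4: "\<bar>f u $ 4 / \<sigma> ^ 3\<bar> \<le> X" if u: "u \<in> Q" for u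
  proof -
    have "\<bar>f u $ 4\<bar> \<le> (\<kappa> * \<sigma> + 5 * M ^ 3 * \<sigma>\<^sup>2) * \<sigma>"
      using C11_increment_le[OF C11 u0(1) u G4 diam[OF u u0(1)]] u0(2) by simp
    also have "\<dots> = X * \<sigma> ^ 3"
      using \<sigma> by (simp add: X_def field_simps power2_eq_square power3_eq_cube)
    finally show ?thesis using \<sigma> by (simp add: abs_divide divide_le_eq)
  qed
  obtain T where T: "finite T" "real (card T) \<le> 2 * X + 2" "\<And>x. \<bar>x\<bar> \<le> X \<Longrightarrow> \<lfloor>x\<rfloor> \<in> T"
    using floor_index[OF X] by blast
  have "ball_cover \<rho> f Q (2 * X + 2) (C * (4 * M * \<sigma>))"
  proof (rule ball_cover_by_index[OF T(1,2)])
    show "(\<lambda>u. \<lfloor>f u $ 4 / \<sigma> ^ 3\<rfloor>) ` Q \<subseteq> T"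
      using f4 T(3) by blast
    fix u v assume uv: "u \<in> Q" "v \<in> Q" and eq: "\<lfloor>f u $ 4 / \<sigma> ^ 3\<rfloor> = \<lfloor>f v $ 4 / \<sigma> ^ 3\<rfloor>"
    have d4: "\<bar>f v $ 4 - f u $ 4\<bar> \<le> \<sigma> ^ 3"
      using floor_div_eq_imp_close[OF eq] \<sigma> by simp
    have d3: "\<bar>f v $ 3 - f u $ 3\<bar> \<le> 4 * M\<^sup>2 * \<sigma> * \<sigma>"
      by (rule C11_increment_le[OF C11 uv G3 diam[OF uv(2,1)]])
    have e2: "\<bar>f u $ 1 * (f v $ 2 - f u $ 2)\<bar> \<le> (M * \<sigma>) * (M * \<sigma>)"
      by (rule abs_mult_le[OF coordinate_le_diam[OF uv(1)] increment_le_diam[OF uv]])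
    have e3: "\<bar>f u $ 1 * (f v $ 3 - f u $ 3)\<bar> \<le> (M * \<sigma>) * (4 * M\<^sup>2 * \<sigma> * \<sigma>)"
      by (rule abs_mult_le[OF coordinate_le_diam[OF uv(1)] d3])
    have e4: "\<bar>(f u $ 1)\<^sup>2 / 2 * (f v $ 2 - f u $ 2)\<bar> \<le> (M * \<sigma>) * ((M * \<sigma>) * (M * \<sigma>)) / 2"
      using abs_mult_le[OF coordinate_le_diam[OF uv(1), of 1] e2] by (simp add: power2_eq_square abs_mult mult.assoc)
    have M3: "\<sigma> ^ 3 \<le> M ^ 3 * \<sigma> ^ 3" "0 \<le> M\<^sup>2 * \<sigma>\<^sup>2"
      using const_ge_1 \<sigma> mult_right_mono[of 1 "M ^ 3" "\<sigma> ^ 3"] by auto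
    have "M * \<sigma> \<le> 4 * M * \<sigma>"
      using const_ge_1 \<sigma> by simp
    show "\<rho> (f u) (f v) \<le> C * (4 * M * \<sigma>)"
    proof (rule box_boundD[OF box])
      show "0 < 4 * M * \<sigma>" using const_ge_1 \<sigma> by simp
      show "\<bar>f v $ 1 - f u $ 1\<bar> \<le> 4 * M * \<sigma>" "\<bar>f v $ 2 - f u $ 2\<bar> \<le> 4 * M * \<sigma>"
        using increment_le_diam[OF uv] \<open>M * \<sigma> \<le> 4 * M * \<sigma>\<close> order_trans by blast+
      have "\<bar>f v $ 3 - f u $ 3 - f u $ 1 * (f v $ 2 - f u $ 2)\<bar> \<le> 5 * (M\<^sup>2 * \<sigma>\<^sup>2)"
        using d3 e2 by (simp add: power2_eq_square mult_ac)
      then show "\<bar>f v $ 3 - f u $ 3 - f u $ 1 * (f v $ 2 - f u $ 2)\<bar> \<le> (4 * M * \<sigma>)\<^sup>2"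
        using M3 by (simp add: power_mult_distrib)
      have "\<bar>f v $ 4 - f u $ 4 - f u $ 1 * (f v $ 3 - f u $ 3) + (f u $ 1)\<^sup>2 / 2 * (f v $ 2 - f u $ 2)\<bar>
          \<le> \<sigma> ^ 3 + 5 * (M ^ 3 * \<sigma> ^ 3)"
        using d4 e3 e4 by (simp add: power2_eq_square power3_eq_cube mult_ac)
      then show "\<bar>f v $ 4 - f u $ 4 - f u $ 1 * (f v $ 3 - f u $ 3) + (f u $ 1)\<^sup>2 / 2 * (f v $ 2 - f u $ 2)\<bar>
          \<le> (4 * M * \<sigma>) ^ 3"
        using M3 by (simp add: power_mult_distrib)
    qed
  qed
  then show ?thesis by (simp add: X_def)
qed

text \<open>
  Write \<open>A\<close> and \<open>B\<close> for the gradients of \<open>f\<^sub>1\<close> and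
  \<open>f\<^sub>3\<close> at the base point and \<open>h\<close> for the displacement from it. Smallness of
  \<open>\<theta>\<^sub>4\<close> makes \<open>(A \<bullet> h) B\<close> an approximation of the gradient of
  \<open>f\<^sub>4\<close>, with error \<open>E\<close>. Its symmetric part is the gradient of \<open>(A
  \<bullet> h) (B \<bullet> h) / 2\<close>, and its antisymmetric part is a rotation with speed proportional to
  the determinant \<open>\<tau>\<close> of \<open>A, B\<close>. A gradient has no circulation, so a triangle
  with a vertex at the base point shows that \<open>\<tau>\<close> is small. Hence \<open>A\<close> may be
  replaced by its component along \<open>B\<close>, and both \<open>f\<^sub>3\<close> and
  \<open>f\<^sub>4\<close> become functions of the single coordinate \<open>t\<close> in the direction of
  \<open>B\<close>, up to admissible errors.
\<close>

lemma cover_degree4: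
  assumes \<kappa>: "0 \<le> \<kappa>" and th4: "\<And>u. u \<in> Q \<Longrightarrow> norm (theta4 f G u) \<le> \<kappa> * \<sigma>"
    and p1: "u0 + (\<sigma> / 4) *\<^sub>R axis 1 1 \<in> Q"
    and p2: "u0 + (\<sigma> / 4) *\<^sub>R axis 1 1 + (\<sigma> / 4) *\<^sub>R axis 2 1 \<in> Q"
  shows "ball_cover \<rho> f Q ((2 * (1 / \<sigma>) + 2) * (2 * (49 * (\<kappa> / \<sigma> + 3 * M ^ 3)) + 2)) (C * (4 * M * \<sigma>))"
proof -
  define A B where "A = G 1 u0" and "B = G 3 u0"
  define E where "E = \<kappa> * \<sigma> + 3 * M ^ 3 * \<sigma>\<^sup>2"
  define \<tau> where "\<tau> = A$1 * B$2 - A$2 * B$1"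
  have E: "0 \<le> E" using \<kappa> \<sigma> const_ge_1 by (simp add: E_def)
  have AB: "norm A \<le> M" "norm B \<le> M"
    unfolding A_def B_def using C11_D(4)[OF C11 u0(1)] by auto
  have M\<sigma>: "M * norm (u - u0) \<le> M * \<sigma>" if "u \<in> Q" for u
    by (rule mult_left_mono[OF diam[OF that u0(1)] const_ge_1(2)])
  have taylor: "\<bar>f u $ i - G i u0 \<bullet> (u - u0)\<bar> \<le> M * \<sigma>\<^sup>2" if "u \<in> Q" for u i
    using C11_taylor[OF C11 u0(1) that diam[OF that u0(1)], of i] u0(2) by simp
  have G4: "norm (G 4 u - (A \<bullet> (u - u0)) *\<^sub>R B) \<le> E" if u: "u \<in> Q" for u
  proof -
    have "G 4 u - (A \<bullet> (u - u0)) *\<^sub>R B = theta4 f G u +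
        (f u $ 1 *\<^sub>R (G 3 u - B) + ((f u $ 1 - A \<bullet> (u - u0)) *\<^sub>R B - ((f u $ 1)\<^sup>2 / 2) *\<^sub>R G 2 u))"
      by (simp add: theta4_def algebra_simps)
    also have "norm \<dots> \<le> \<kappa> * \<sigma> + ((M * \<sigma>) * (M * \<sigma>) + ((M * \<sigma>\<^sup>2) * M + ((M * \<sigma>)\<^sup>2 / 2) * M))"
    proof (rule norm_triangle4[OF th4[OF u] norm_scaleR_le[OF coordinate_le_diam[OF u]] norm_scaleR_le[OF _ AB(2)]
          norm_scaleR_le[OF _ C11_D(4)[OF C11 u]]])
      show "\<bar>(f u $ 1)\<^sup>2 / 2\<bar> \<le> (M * \<sigma>)\<^sup>2 / 2"
        using coordinate_le_diam[OF u, of 1] power_mono[of "\<bar>f u $ 1\<bar>" "M * \<sigma>" 2] by simp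
      show "norm (G 3 u - B) \<le> M * \<sigma>"
        using C11_D(5)[OF C11 u u0(1), of 3] M\<sigma>[OF u] by (simp add: B_def)
      show "\<bar>f u $ 1 - A \<bullet> (u - u0)\<bar> \<le> M * \<sigma>\<^sup>2"
        using taylor[OF u] by (simp add: A_def)
    qed
    also have "\<dots> = \<kappa> * \<sigma> + (2 * (M\<^sup>2 * \<sigma>\<^sup>2) + M ^ 3 * \<sigma>\<^sup>2 / 2)"
      by (simp add: power2_eq_square power3_eq_cube algebra_simps)
    also have "\<dots> \<le> E"
    proof -
      have "M\<^sup>2 * \<sigma>\<^sup>2 \<le> M ^ 3 * \<sigma>\<^sup>2" "0 \<le> M ^ 3 * \<sigma>\<^sup>2"
        using const_ge_1 by (auto intro: mult_right_mono)
      then show ?thesis unfolding E_def by linarith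
    qed
    finally show ?thesis .
  qed
  define g where "g u = f u $ 4 - (A \<bullet> (u - u0)) * (B \<bullet> (u - u0)) / 2" for u
  \<comment> \<open>Subtracting the symmetric part leaves the error term and the rotation.\<close>
  define H where "H u = (G 4 u - (A \<bullet> (u - u0)) *\<^sub>R B) +
      (1 / 2) *\<^sub>R ((A \<bullet> (u - u0)) *\<^sub>R B - (B \<bullet> (u - u0)) *\<^sub>R A)" for u
  have der: "(g has_derivative (\<lambda>k. H u \<bullet> k)) (at u within Q)" if "u \<in> Q" for u
    unfolding g_def
    by (rule derivative_eq_intros C11_D(3)[OF C11 that] refl | simp)+
       (simp add: H_def fun_eq_iff inner_diff_left inner_add_left field_simps)
  have radial: "\<bar>g u\<bar> \<le> E * \<sigma>" if u: "u \<in> Q" for u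
  proof -
    have "\<bar>H (u0 + t *\<^sub>R (u - u0)) \<bullet> (u - u0) - 0\<bar> \<le> E * \<sigma>" if "0 \<le> t" "t \<le> 1" for t
    proof -
      have "H (u0 + t *\<^sub>R (u - u0)) \<bullet> (u - u0)
          = (G 4 (u0 + t *\<^sub>R (u - u0)) - (A \<bullet> (u0 + t *\<^sub>R (u - u0) - u0)) *\<^sub>R B) \<bullet> (u - u0)"
        by (simp add: H_def inner_add_left inner_diff_left)
      then show ?thesis
        using inner_abs_le[OF G4[OF C11_segment[OF C11 u0(1) u that]] diam[OF u u0(1)]] by simp
    qed
    from mvt_on_segment[of Q u0 "u - u0" g H, OF C11_D(1)[OF C11] u0(1) _ der this] u u0
    show ?thesis by (simp add: g_def)
  qed
  have \<tau>: "\<bar>\<tau>\<bar> * \<sigma>\<^sup>2 \<le> 96 * (E * \<sigma>)"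
  proof -
    define l where "l = \<sigma> / 4"
    define p h :: "real^2" where "p = u0 + l *\<^sub>R axis 1 1" and "h = l *\<^sub>R axis 2 1"
    have p: "p \<in> Q" "p + h \<in> Q" using p1 p2 by (simp_all add: p_def h_def l_def)
    have "\<bar>H (p + t *\<^sub>R h) \<bullet> h - l\<^sup>2 * \<tau> / 2\<bar> \<le> E * \<sigma>" if "0 \<le> t" "t \<le> 1" for t
    proof -
      have q: "p + t *\<^sub>R h \<in> Q"
        using C11_segment[OF C11 p that] by simp
      have "H (p + t *\<^sub>R h) \<bullet> h
          = (G 4 (p + t *\<^sub>R h) - (A \<bullet> (p + t *\<^sub>R h - u0)) *\<^sub>R B) \<bullet> h + l\<^sup>2 * \<tau> / 2"
        by (simp add: H_def inner_add_left inner_diff_left p_def h_def \<tau>_def inner_axis inner_add_right)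
           (simp add: algebra_simps power2_eq_square)
      moreover have "norm h \<le> \<sigma>"
        using diam[OF p(2,1)] by simp
      ultimately show ?thesis
        using inner_abs_le[OF G4[OF q]] by simp
    qed
    \<comment> \<open>The side of the triangle opposite to the base point carries all the circulation; the two
      other sides lie on rays, where \<open>radial\<close> applies.\<close>
    from mvt_on_segment[of Q p h g H, OF C11_D(1)[OF C11] p der this]
    have "\<bar>g (p + h) - g p - l\<^sup>2 * \<tau> / 2\<bar> \<le> E * \<sigma>" by simp
    then have "\<bar>l\<^sup>2 * \<tau>\<bar> \<le> 6 * (E * \<sigma>)"
      using radial[OF p(1)] radial[OF p(2)] by linarith
    then show ?thesis by (simp add: l_def abs_mult power_divide mult.commute)
  qed
  obtain l b where l: "norm l = 1" and b: "B = b *\<^sub>R l"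
    by (rule parallel_vectors[of B 0]) auto
  define t where "t u = l \<bullet> (u - u0)" for u
  define c where "c = (A \<bullet> l) * b / 2"
  have bM: "\<bar>b\<bar> \<le> M" using AB(2) l by (simp add: b)
  have cM: "\<bar>c\<bar> \<le> M\<^sup>2 / 2"
  proof -
    have "\<bar>A \<bullet> l\<bar> \<le> M * 1" using l by (intro inner_abs_le AB) simp
    from abs_mult_le[OF this bM] show ?thesis by (simp add: c_def power2_eq_square)
  qed
  have tb: "\<bar>t u\<bar> \<le> \<sigma>" if "u \<in> Q" for u
    using inner_abs_le[of l 1 "u - u0" \<sigma>] l diam[OF that u0(1)] by (simp add: t_def)
  have f3: "\<bar>f u $ 3 - b * t u\<bar> \<le> M * \<sigma>\<^sup>2" if "u \<in> Q" for u
    using taylor[OF that, of 3] b by (simp add: B_def t_def)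
  define X where "X = 49 * (\<kappa> / \<sigma> + 3 * M ^ 3)"
  have X: "0 \<le> X" using \<kappa> \<sigma> const_ge_1 by (simp add: X_def)
  have f4: "\<bar>(f u $ 4 - c * (t u)\<^sup>2) / \<sigma> ^ 3\<bar> \<le> X" if u: "u \<in> Q" for u
  proof -
    \<comment> \<open>The coordinate orthogonal to \<open>l\<close>; the term in which it occurs carries the factor \<open>\<tau>\<close>.\<close>
    define s where "s = vector [- (l$2), l$1] \<bullet> (u - u0)"
    have "norm (vector [- (l$2), l$1] :: real^2) = 1"
      using l by (simp add: norm_vec_def L2_set_def sum_2 vector_2 add.commute)
    then have s: "\<bar>s\<bar> \<le> \<sigma>"
      using inner_abs_le[of "vector [- (l$2), l$1]" 1 "u - u0" \<sigma>] diam[OF u u0(1)] by (simp add: s_def)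
    have ll: "l$1 * l$1 + l$2 * l$2 = 1"
      using l by (simp add: norm_eq_1 inner_vec_def sum_2)
    have Ah: "A \<bullet> (u - u0) = (A \<bullet> l) * t u + (l$1 * A$2 - l$2 * A$1) * s"
    proof -
      have "(A \<bullet> l) * t u + (l$1 * A$2 - l$2 * A$1) * s = (l$1 * l$1 + l$2 * l$2) * (A \<bullet> (u - u0))"
        by (simp add: t_def s_def inner_vec_def sum_2 vector_2 algebra_simps)
      then show ?thesis using ll by simp
    qed
    have Bh: "B \<bullet> (u - u0) = b * t u"
      by (simp add: b t_def)
    have \<tau>b: "\<tau> = b * (A$1 * l$2 - A$2 * l$1)"
      by (simp add: \<tau>_def b algebra_simps)
    have "(A \<bullet> (u - u0)) * (B \<bullet> (u - u0)) / 2 - c * (t u)\<^sup>2 = - (\<tau> * (t u * s) / 2)"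
      unfolding Ah Bh \<tau>b c_def by (simp add: field_simps power2_eq_square)
    moreover have "\<bar>\<tau> * (t u * s)\<bar> \<le> \<bar>\<tau>\<bar> * (\<sigma> * \<sigma>)"
      by (intro abs_mult_le tb u s) simp
    ultimately have "\<bar>f u $ 4 - c * (t u)\<^sup>2\<bar> \<le> 49 * (E * \<sigma>)"
      using radial[OF u] \<tau> unfolding g_def power2_eq_square by linarith
    also have "\<dots> = X * \<sigma> ^ 3"
      using \<sigma> by (simp add: X_def E_def field_simps power2_eq_square power3_eq_cube)
    finally show ?thesis using \<sigma> by (simp add: abs_divide divide_le_eq)
  qed
  obtain T where T: "finite T" "real (card T) \<le> 2 * X + 2" "\<And>x. \<bar>x\<bar> \<le> X \<Longrightarrow> \<lfloor>x\<rfloor> \<in> T"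
    using floor_index[OF X] by blast
  have "0 \<le> 1 / \<sigma>" using \<sigma> by simp
  then obtain T' where T': "finite T'" "real (card T') \<le> 2 * (1 / \<sigma>) + 2" "\<And>x. \<bar>x\<bar> \<le> 1 / \<sigma> \<Longrightarrow> \<lfloor>x\<rfloor> \<in> T'"
    using floor_index by blast
  have "ball_cover \<rho> f Q ((2 * (1 / \<sigma>) + 2) * (2 * X + 2)) (C * (4 * M * \<sigma>))"
  proof (rule ball_cover_by_index)
    show "finite (T' \<times> T)" using T T' by simp
    show "real (card (T' \<times> T)) \<le> (2 * (1 / \<sigma>) + 2) * (2 * X + 2)"
      unfolding card_cartesian_product of_nat_mult using T T' \<sigma> by (intro mult_mono) auto
    have "\<bar>t u / \<sigma>\<^sup>2\<bar> \<le> 1 / \<sigma>" if "u \<in> Q" for u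
      using tb[OF that] \<sigma> by (simp add: abs_divide divide_le_eq power2_eq_square)
    then show "(\<lambda>u. (\<lfloor>t u / \<sigma>\<^sup>2\<rfloor>, \<lfloor>(f u $ 4 - c * (t u)\<^sup>2) / \<sigma> ^ 3\<rfloor>)) ` Q \<subseteq> T' \<times> T"
      using f4 T(3) T'(3) by blast
    fix u v assume uv: "u \<in> Q" "v \<in> Q" and eq: "(\<lfloor>t u / \<sigma>\<^sup>2\<rfloor>, \<lfloor>(f u $ 4 - c * (t u)\<^sup>2) / \<sigma> ^ 3\<rfloor>)
        = (\<lfloor>t v / \<sigma>\<^sup>2\<rfloor>, \<lfloor>(f v $ 4 - c * (t v)\<^sup>2) / \<sigma> ^ 3\<rfloor>)"
    have tt: "\<bar>t v - t u\<bar> \<le> \<sigma>\<^sup>2"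
      using floor_div_eq_imp_close[of "t u" "\<sigma>\<^sup>2" "t v"] eq \<sigma> by auto
    have d3: "\<bar>f v $ 3 - f u $ 3\<bar> \<le> 3 * (M * \<sigma>\<^sup>2)"
      using f3[OF uv(1)] f3[OF uv(2)] abs_mult_le[OF bM tt] by (simp add: right_diff_distrib)
    have d4: "\<bar>f v $ 4 - f u $ 4\<bar> \<le> \<sigma> ^ 3 + M\<^sup>2 * \<sigma> ^ 3"
    proof -
      have "\<bar>(f v $ 4 - c * (t v)\<^sup>2) - (f u $ 4 - c * (t u)\<^sup>2)\<bar> \<le> \<sigma> ^ 3"
        using floor_div_eq_imp_close[of "f u $ 4 - c * (t u)\<^sup>2" "\<sigma> ^ 3" "f v $ 4 - c * (t v)\<^sup>2"] eq \<sigma> by auto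
      moreover have "\<bar>c * ((t v - t u) * (t v + t u))\<bar> \<le> M\<^sup>2 / 2 * (\<sigma>\<^sup>2 * (2 * \<sigma>))"
        using tb[OF uv(1)] tb[OF uv(2)] by (intro abs_mult_le cM tt) linarith
      ultimately show ?thesis
        by (simp add: power2_eq_square power3_eq_cube algebra_simps)
    qed
    have e2: "\<bar>f u $ 1 * (f v $ 2 - f u $ 2)\<bar> \<le> (M * \<sigma>) * (M * \<sigma>)"
      by (rule abs_mult_le[OF coordinate_le_diam[OF uv(1)] increment_le_diam[OF uv]])
    have e3: "\<bar>f u $ 1 * (f v $ 3 - f u $ 3)\<bar> \<le> (M * \<sigma>) * (3 * (M * \<sigma>\<^sup>2))"
      by (rule abs_mult_le[OF coordinate_le_diam[OF uv(1)] d3])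
    have e4: "\<bar>(f u $ 1)\<^sup>2 / 2 * (f v $ 2 - f u $ 2)\<bar> \<le> (M * \<sigma>) * ((M * \<sigma>) * (M * \<sigma>)) / 2"
      using abs_mult_le[OF coordinate_le_diam[OF uv(1), of 1] e2] by (simp add: power2_eq_square abs_mult mult.assoc)
    have M3: "\<sigma> ^ 3 \<le> M ^ 3 * \<sigma> ^ 3" "M\<^sup>2 * \<sigma> ^ 3 \<le> M ^ 3 * \<sigma> ^ 3" "0 \<le> M\<^sup>2 * \<sigma>\<^sup>2" "M * \<sigma>\<^sup>2 \<le> M\<^sup>2 * \<sigma>\<^sup>2"
      using const_ge_1 \<sigma> mult_right_mono[of 1 "M ^ 3" "\<sigma> ^ 3"] by (auto intro: mult_right_mono)
    have "M * \<sigma> \<le> 4 * M * \<sigma>"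
      using const_ge_1 \<sigma> by simp
    show "\<rho> (f u) (f v) \<le> C * (4 * M * \<sigma>)"
    proof (rule box_boundD[OF box])
      show "0 < 4 * M * \<sigma>" using const_ge_1 \<sigma> by simp
      show "\<bar>f v $ 1 - f u $ 1\<bar> \<le> 4 * M * \<sigma>" "\<bar>f v $ 2 - f u $ 2\<bar> \<le> 4 * M * \<sigma>"
        using increment_le_diam[OF uv] \<open>M * \<sigma> \<le> 4 * M * \<sigma>\<close> order_trans by blast+
      have "(M * \<sigma>) * (M * \<sigma>) = M\<^sup>2 * \<sigma>\<^sup>2" by (simp add: power2_eq_square mult_ac)
      then have "\<bar>f v $ 3 - f u $ 3 - f u $ 1 * (f v $ 2 - f u $ 2)\<bar> \<le> 16 * (M\<^sup>2 * \<sigma>\<^sup>2)"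
        using d3 e2 M3(3,4) by linarith
      then show "\<bar>f v $ 3 - f u $ 3 - f u $ 1 * (f v $ 2 - f u $ 2)\<bar> \<le> (4 * M * \<sigma>)\<^sup>2"
        by (simp add: power_mult_distrib)
      have "(M * \<sigma>) * (3 * (M * \<sigma>\<^sup>2)) = 3 * (M\<^sup>2 * \<sigma> ^ 3)"
        "(M * \<sigma>) * ((M * \<sigma>) * (M * \<sigma>)) = M ^ 3 * \<sigma> ^ 3"
        by (simp_all add: power2_eq_square power3_eq_cube mult_ac)
      then have "\<bar>f v $ 4 - f u $ 4 - f u $ 1 * (f v $ 3 - f u $ 3) + (f u $ 1)\<^sup>2 / 2 * (f v $ 2 - f u $ 2)\<bar>
          \<le> 64 * (M ^ 3 * \<sigma> ^ 3)"
        using d4 e3 e4 M3(1,2) by linarith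
      then show "\<bar>f v $ 4 - f u $ 4 - f u $ 1 * (f v $ 3 - f u $ 3) + (f u $ 1)\<^sup>2 / 2 * (f v $ 2 - f u $ 2)\<bar>
          \<le> (4 * M * \<sigma>) ^ 3"
        by (simp add: power_mult_distrib)
    qed
  qed
  then show ?thesis by (simp add: X_def)
qed

end

section \<open>Small covers of the points of low degree\<close>

context
  fixes \<rho> :: "real^4 \<Rightarrow> real^4 \<Rightarrow> real" and M B \<phi> G e N C
  assumes inv: "\<And>q x y. \<rho> (engel_mult q x) (engel_mult q y) = \<rho> x y"
    and box: "box_bound \<rho> C" "1 \<le> C"
    and C11: "C11_bounded M B \<phi> G" and bd: "\<And>u. u \<in> B \<Longrightarrow> \<bar>\<phi> u $ 1\<bar> \<le> M"
    and e: "0 < e" "\<And>u v. u \<in> N \<Longrightarrow> norm (v - u) \<le> e \<Longrightarrow> v \<in> B"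
    and N: "bounded N"
begin

lemma cell_in_domain:
  assumes "2 / 2 ^ k \<le> e" "c \<in> dyadic_cell k ` N" "dyadic_cell k u = c"
  shows "u \<in> B"
proof -
  obtain v where "v \<in> N" "dyadic_cell k u = dyadic_cell k v" using assms by auto
  then show ?thesis
    using dyadic_cell_eq_imp_norm_le[of k u v] assms(1) by (intro e(2)[of v]) auto
qed

text \<open>
  Moving a point of the square to the origin costs nothing, as the distance and both forms are left invariant.
\<close>

lemma normalised_cell:
  assumes "2 / 2 ^ k \<le> e" "c \<in> dyadic_cell k ` N" "dyadic_cell k u0 = c"
  obtains f G' where "C11_bounded (3 * M ^ 3) {u. dyadic_cell k u = c} f G'" "f u0 = 0"
    "\<And>u. theta3 f G' u = theta3 \<phi> G u" "\<And>u. theta4 f G' u = theta4 \<phi> G u"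
    "\<And>n R. ball_cover \<rho> f {u. dyadic_cell k u = c} n R \<Longrightarrow> ball_cover \<rho> \<phi> (N \<inter> {u. dyadic_cell k u = c}) n R"
proof -
  obtain q where q: "engel_mult q (\<phi> u0) = 0"
    using engel_mult_inverse by blast
  have "q $ 1 + \<phi> u0 $ 1 = 0"
    using arg_cong[OF q, of "\<lambda>x. x $ 1"] by simp
  then have "\<bar>q $ 1\<bar> \<le> M"
    using bd[OF cell_in_domain[OF assms]] by linarith
  moreover have "{u. dyadic_cell k u = c} \<subseteq> B"
    using cell_in_domain[OF assms(1,2)] by blast
  ultimately obtain G' where G': "C11_bounded (3 * M ^ 3) {u. dyadic_cell k u = c} (\<lambda>u. engel_mult q (\<phi> u)) G'"
    "\<And>u. theta3 (\<lambda>u. engel_mult q (\<phi> u)) G' u = theta3 \<phi> G u"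
    "\<And>u. theta4 (\<lambda>u. engel_mult q (\<phi> u)) G' u = theta4 \<phi> G u"
    using C11_bounded_left_translate[OF C11 _ convex_dyadic_cell] by blast
  show thesis
  proof (rule that[OF G'(1) q G'(2,3)])
    fix n R assume "ball_cover \<rho> (\<lambda>u. engel_mult q (\<phi> u)) {u. dyadic_cell k u = c} n R"
    then have "ball_cover \<rho> \<phi> {u. dyadic_cell k u = c} n R"
      by (simp add: ball_cover_def inv)
    then show "ball_cover \<rho> \<phi> (N \<inter> {u. dyadic_cell k u = c}) n R"
      by (rule ball_cover_mono) auto
  qed
qed

lemma eventually_small_cells: "\<exists>k1. \<forall>k\<ge>k1. 2 / 2 ^ k \<le> e \<and> 2 / 2 ^ k \<le> (1 :: real)"
proof -
  have "(\<lambda>k. 2 / 2 ^ k :: real) \<longlonglongrightarrow> 0" by real_asymp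
  then have "\<forall>\<^sub>F k in sequentially. 2 / 2 ^ k < min e 1"
    using e by (intro order_tendstoD(2)) auto
  then show ?thesis unfolding eventually_sequentially by (auto intro: less_imp_le)
qed

lemma translated_const_pos: "1 \<le> 3 * M ^ 3" "0 < C * (4 * (3 * M ^ 3))"
  using C11_D(2)[OF C11] power_bounds_ge_1[of M] box(2) by auto

lemma cell_diameter: "dyadic_cell k u = c \<Longrightarrow> dyadic_cell k v = c \<Longrightarrow> norm (u - v) \<le> 2 / 2 ^ k"
  by (intro dyadic_cell_eq_imp_norm_le) simp

lemma theta4_cell_lipschitz:
  assumes "theta4 \<phi> G v = 0" "2 / 2 ^ k \<le> e" "v \<in> N" "dyadic_cell k u = dyadic_cell k v"
  shows "norm (theta4 \<phi> G u) \<le> 5 * M ^ 3 * norm (u - v)"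
  using theta4_lipschitz[OF C11 bd, of u v] assms cell_in_domain[OF assms(2), of "dyadic_cell k v"] by auto

lemma has_small_covers_degree3:
  assumes th: "\<And>u. u \<in> N \<Longrightarrow> theta3 \<phi> G u = 0 \<and> theta4 \<phi> G u = 0"
  shows "has_small_covers \<rho> 3 (\<phi> ` N)"
proof -
  obtain k1 where k1: "\<And>k. k \<ge> k1 \<Longrightarrow> 2 / 2 ^ k \<le> e \<and> 2 / 2 ^ k \<le> (1 :: real)"
    using eventually_small_cells by blast
  define M' where "M' = 3 * M ^ 3"
  define A where "A = C * (4 * M')"
  define H where "H = 10 * M' ^ 3 + 2"
  have M': "1 \<le> M'" "0 < A" using translated_const_pos by (simp_all add: M'_def A_def)
  have H: "2 \<le> H" using M' by (simp add: H_def)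
  show ?thesis
  proof (rule has_small_covers_by_flat_cells[OF N M'(2), where h = "theta4 \<phi> G" and \<Lambda> = "5 * M ^ 3"
        and kmin = k1 and D = "4 * A ^ 3 * H"])
    show "0 \<le> 4 * A ^ 3 * H" "0 \<le> 5 * M ^ 3" using M' H C11_D(2)[OF C11] by auto
    show "norm (theta4 \<phi> G u) \<le> 5 * M ^ 3 * norm (u - v)"
      if "k \<ge> k1" "v \<in> N" "dyadic_cell k u = dyadic_cell k v" for k u v
      using theta4_cell_lipschitz th k1 that by blast
    fix k c \<kappa> assume k: "k \<ge> k1" and c: "c \<in> dyadic_cell k ` N" and \<kappa>: "(0::real) \<le> \<kappa>"
      and flat: "\<And>u. dyadic_cell k u = c \<Longrightarrow> norm (theta4 \<phi> G u) \<le> \<kappa> * (2 / 2 ^ k)"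
    define \<sigma> where "\<sigma> = (2 / 2 ^ k :: real)"
    have \<sigma>: "0 < \<sigma>" "\<sigma> \<le> 1" "\<sigma> \<le> e" using k1[OF k] by (auto simp: \<sigma>_def)
    have \<sigma>2: "\<sigma>\<^sup>2 = 4 / 4 ^ k" unfolding \<sigma>_def by (rule dyadic_scale_squared)
    obtain z where z: "z \<in> N" "dyadic_cell k z = c" using c by blast
    obtain f G' where f: "C11_bounded M' {u. dyadic_cell k u = c} f G'" "f z = 0"
      "\<And>u. theta3 f G' u = theta3 \<phi> G u" "\<And>u. theta4 f G' u = theta4 \<phi> G u"
      "\<And>n R. ball_cover \<rho> f {u. dyadic_cell k u = c} n R \<Longrightarrow> ball_cover \<rho> \<phi> (N \<inter> {u. dyadic_cell k u = c}) n R"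
      using normalised_cell[OF \<sigma>(3)[unfolded \<sigma>_def] c z(2)] unfolding M'_def by blast
    have AR: "C * (4 * M' * \<sigma>) = A * \<sigma>" by (simp add: A_def)
    have "ball_cover \<rho> f {u. dyadic_cell k u = c} (2 * (\<kappa> / \<sigma> + 5 * M' ^ 3) + 2) (C * (4 * M' * \<sigma>))"
    proof (rule cover_degree3[OF f(1) box(1) _ f(2) \<sigma>(1,2) _ \<kappa>])
      show "norm (theta4 f G' u) \<le> \<kappa> * \<sigma>" if "u \<in> {u. dyadic_cell k u = c}" for u
        using that flat by (simp add: f(4) \<sigma>_def)
      show "theta3 f G' z = 0" using z th by (simp add: f(3))
    qed (use z cell_diameter in \<open>auto simp: \<sigma>_def\<close>)
    moreover have "(2 * (\<kappa> / \<sigma> + 5 * M' ^ 3) + 2) * (A * \<sigma>) ^ 3 \<le> 4 * A ^ 3 * H * (\<kappa> + \<sigma>) / 4 ^ k"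
    proof -
      have "(2 * (\<kappa> / \<sigma> + 5 * M' ^ 3) + 2) * (A * \<sigma>) ^ 3 = A ^ 3 * \<sigma>\<^sup>2 * (2 * \<kappa> + H * \<sigma>)"
        using \<sigma> by (simp add: H_def field_simps power2_eq_square power3_eq_cube)
      also have "\<dots> \<le> A ^ 3 * \<sigma>\<^sup>2 * (H * (\<kappa> + \<sigma>))"
        using M' mult_right_mono[OF H \<kappa>] by (intro mult_left_mono) (auto simp: distrib_left)
      also have "\<dots> = 4 * A ^ 3 * H * (\<kappa> + \<sigma>) / 4 ^ k"
        unfolding \<sigma>2 by simp
      finally show ?thesis .
    qed
    ultimately show "\<exists>n. n * (A * (2 / 2 ^ k)) ^ 3 \<le> 4 * A ^ 3 * H * (\<kappa> + 2 / 2 ^ k) / 4 ^ k \<and>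
        ball_cover \<rho> \<phi> (N \<inter> {u. dyadic_cell k u = c}) n (A * (2 / 2 ^ k))"
      unfolding \<sigma>_def[symmetric] AR by (blast intro: f(5))
  qed
qed

lemma has_small_covers_degree4:
  assumes th: "\<And>u. u \<in> N \<Longrightarrow> theta4 \<phi> G u = 0"
  shows "has_small_covers \<rho> 4 (\<phi> ` N)"
proof -
  obtain k1 where k1: "\<And>k. k \<ge> k1 \<Longrightarrow> 2 / 2 ^ k \<le> e \<and> 2 / 2 ^ k \<le> (1 :: real)"
    using eventually_small_cells by blast
  define M' where "M' = 3 * M ^ 3"
  define A where "A = C * (4 * M')"
  define H where "H = 294 * M' ^ 3 + 2"
  have M': "1 \<le> M'" "0 < A" using translated_const_pos by (simp_all add: M'_def A_def)
  have H: "98 \<le> H" using power_bounds_ge_1(5)[OF M'(1)] by (simp add: H_def)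
  show ?thesis
  proof (rule has_small_covers_by_flat_cells[OF N M'(2), where h = "theta4 \<phi> G" and \<Lambda> = "5 * M ^ 3"
        and kmin = k1 and D = "16 * A ^ 4 * H"])
    show "0 \<le> 16 * A ^ 4 * H" "0 \<le> 5 * M ^ 3" using M' H C11_D(2)[OF C11] by auto
    show "norm (theta4 \<phi> G u) \<le> 5 * M ^ 3 * norm (u - v)"
      if "k \<ge> k1" "v \<in> N" "dyadic_cell k u = dyadic_cell k v" for k u v
      using theta4_cell_lipschitz th k1 that by blast
    fix k c \<kappa> assume k: "k \<ge> k1" and c: "c \<in> dyadic_cell k ` N" and \<kappa>: "(0::real) \<le> \<kappa>"
      and flat: "\<And>u. dyadic_cell k u = c \<Longrightarrow> norm (theta4 \<phi> G u) \<le> \<kappa> * (2 / 2 ^ k)"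
    define \<sigma> where "\<sigma> = (2 / 2 ^ k :: real)"
    have \<sigma>: "0 < \<sigma>" "\<sigma> \<le> 1" "\<sigma> \<le> e" using k1[OF k] by (auto simp: \<sigma>_def)
    have \<sigma>2: "\<sigma>\<^sup>2 = 4 / 4 ^ k" unfolding \<sigma>_def by (rule dyadic_scale_squared)
    \<comment> \<open>The lower left corner belongs to the half open square, and so does the triangle with legs
      \<open>\<sigma> / 4\<close>, half the side of the square.\<close>
    define p :: "real^2" where "p = vector [of_int (fst c) / 2 ^ k, of_int (snd c) / 2 ^ k]"
    have p: "dyadic_cell k p = c" "dyadic_cell k (p + (\<sigma> / 4) *\<^sub>R axis 1 1) = c"
      "dyadic_cell k (p + (\<sigma> / 4) *\<^sub>R axis 1 1 + (\<sigma> / 4) *\<^sub>R axis 2 1) = c"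
      by (simp_all add: dyadic_cell_def p_def \<sigma>_def vector_2 axis_def prod_eq_iff distrib_left floor_eq_iff)
    obtain f G' where f: "C11_bounded M' {u. dyadic_cell k u = c} f G'" "f p = 0"
      "\<And>u. theta3 f G' u = theta3 \<phi> G u" "\<And>u. theta4 f G' u = theta4 \<phi> G u"
      "\<And>n R. ball_cover \<rho> f {u. dyadic_cell k u = c} n R \<Longrightarrow> ball_cover \<rho> \<phi> (N \<inter> {u. dyadic_cell k u = c}) n R"
      using normalised_cell[OF \<sigma>(3)[unfolded \<sigma>_def] c p(1)] unfolding M'_def by blast
    have AR: "C * (4 * M' * \<sigma>) = A * \<sigma>" by (simp add: A_def)
    have "ball_cover \<rho> f {u. dyadic_cell k u = c}
        ((2 * (1 / \<sigma>) + 2) * (2 * (49 * (\<kappa> / \<sigma> + 3 * M' ^ 3)) + 2)) (C * (4 * M' * \<sigma>))"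
    proof (rule cover_degree4[OF f(1) box(1) _ f(2) \<sigma>(1,2) _ \<kappa>])
      show "norm (theta4 f G' u) \<le> \<kappa> * \<sigma>" if "u \<in> {u. dyadic_cell k u = c}" for u
        using that flat by (simp add: f(4) \<sigma>_def)
    qed (use p cell_diameter in \<open>auto simp: \<sigma>_def\<close>)
    moreover have "((2 * (1 / \<sigma>) + 2) * (2 * (49 * (\<kappa> / \<sigma> + 3 * M' ^ 3)) + 2)) * (A * \<sigma>) ^ 4
        \<le> 16 * A ^ 4 * H * (\<kappa> + \<sigma>) / 4 ^ k"
    proof -
      have 1: "(2 * (1 / \<sigma>) + 2) * \<sigma> = 2 + 2 * \<sigma>" "(2 * (49 * (\<kappa> / \<sigma> + 3 * M' ^ 3)) + 2) * \<sigma> = 98 * \<kappa> + H * \<sigma>"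
        using \<sigma> by (simp_all add: H_def field_simps)
      have "X * Y * (A * \<sigma>) ^ 4 = A ^ 4 * \<sigma>\<^sup>2 * ((X * \<sigma>) * (Y * \<sigma>))" for X Y
        by (simp add: power_mult_distrib eval_nat_numeral mult_ac)
      then have "((2 * (1 / \<sigma>) + 2) * (2 * (49 * (\<kappa> / \<sigma> + 3 * M' ^ 3)) + 2)) * (A * \<sigma>) ^ 4
          = A ^ 4 * \<sigma>\<^sup>2 * ((2 + 2 * \<sigma>) * (98 * \<kappa> + H * \<sigma>))"
        by (simp only: 1)
      also have "\<dots> \<le> A ^ 4 * \<sigma>\<^sup>2 * (4 * (H * (\<kappa> + \<sigma>)))"
        using M' \<sigma> \<kappa> H mult_right_mono[OF H \<kappa>] by (intro mult_left_mono mult_mono) (auto simp: distrib_left)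
      also have "\<dots> = 16 * A ^ 4 * H * (\<kappa> + \<sigma>) / 4 ^ k"
        unfolding \<sigma>2 by simp
      finally show ?thesis .
    qed
    ultimately show "\<exists>n. n * (A * (2 / 2 ^ k)) ^ 4 \<le> 16 * A ^ 4 * H * (\<kappa> + 2 / 2 ^ k) / 4 ^ k \<and>
        ball_cover \<rho> \<phi> (N \<inter> {u. dyadic_cell k u = c}) n (A * (2 / 2 ^ k))"
      unfolding \<sigma>_def[symmetric] AR by (blast intro: f(5))
  qed
qed

lemma has_small_covers_degree5:
  assumes par: "\<And>u. u \<in> N \<Longrightarrow> theta3 \<phi> G u $ 1 * theta4 \<phi> G u $ 2 = theta3 \<phi> G u $ 2 * theta4 \<phi> G u $ 1"
  shows "has_small_covers \<rho> 5 (\<phi> ` N)"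
proof (rule has_small_covers_by_cells[OF N])
  fix \<eta> \<delta> :: real assume \<eta>: "\<eta> > 0" and \<delta>: "\<delta> > 0"
  define M' where "M' = 3 * M ^ 3"
  define A where "A = C * (4 * M')"
  have M': "1 \<le> M'" "0 < A" using translated_const_pos by (simp_all add: M'_def A_def)
  \<comment> \<open>With \<open>r\<^sup>2 = \<epsilon> \<sigma>\<close> and \<open>\<sigma>\<^sup>2 = 4 / 4\<^sup>k\<close>, the cost of a square is at most \<open>16 A\<^sup>5 \<epsilon> / 4\<^sup>k\<close>.\<close>
  define \<epsilon> where "\<epsilon> = min 1 (\<eta> / (16 * A ^ 5))"
  have \<epsilon>: "0 < \<epsilon>" "\<epsilon> \<le> 1" "16 * A ^ 5 * \<epsilon> \<le> \<eta>"
    using \<eta> M' by (auto simp: \<epsilon>_def min_def field_simps)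
  define r where "r k = sqrt (\<epsilon> * (2 / 2 ^ k))" for k :: nat
  obtain k1 where k1: "\<And>k. k \<ge> k1 \<Longrightarrow> 2 / 2 ^ k \<le> e \<and> 2 / 2 ^ k \<le> (1 :: real)"
    using eventually_small_cells by blast
  have s0: "(\<lambda>k. 2 / 2 ^ k :: real) \<longlonglongrightarrow> 0" by real_asymp
  have "(\<lambda>k. A * r k) \<longlonglongrightarrow> A * sqrt (\<epsilon> * 0)"
    unfolding r_def by (intro tendsto_intros s0)
  then have "\<forall>\<^sub>F k in sequentially. A * r k < \<delta>"
    using \<delta> by (intro order_tendstoD(2)[where y = "A * sqrt (\<epsilon> * 0)"]) auto
  moreover have "\<forall>\<^sub>F k in sequentially. 2 / 2 ^ k < \<epsilon> ^ 3"
    using \<epsilon> by (intro order_tendstoD(2)[OF s0]) auto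
  ultimately have "\<forall>\<^sub>F k in sequentially. A * r k < \<delta> \<and> 2 / 2 ^ k < \<epsilon> ^ 3 \<and> k \<ge> k1"
    by (intro eventually_conj eventually_ge_at_top)
  then obtain k0 where k0: "\<And>k. k \<ge> k0 \<Longrightarrow> A * r k < \<delta> \<and> 2 / 2 ^ k < \<epsilon> ^ 3 \<and> k \<ge> k1"
    unfolding eventually_sequentially by blast
  have rpos: "0 < r k" for k using \<epsilon> by (simp add: r_def)
  have "\<exists>n. n * (A * r k) ^ 5 \<le> \<eta> / 4 ^ k \<and> ball_cover \<rho> \<phi> (N \<inter> {u. dyadic_cell k u = c}) n (A * r k)"
    if k: "k \<ge> k0" and c: "c \<in> dyadic_cell k ` N" for k c
  proof -
    define \<sigma> where "\<sigma> = (2 / 2 ^ k :: real)"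
    have \<sigma>: "0 < \<sigma>" "\<sigma> \<le> 1" "\<sigma> \<le> e" "\<sigma> \<le> \<epsilon> ^ 3" using k0[OF k] k1[of k] by (auto simp: \<sigma>_def)
    have \<sigma>2: "\<sigma>\<^sup>2 = 4 / 4 ^ k" unfolding \<sigma>_def by (rule dyadic_scale_squared)
    have r2: "(r k)\<^sup>2 = \<epsilon> * \<sigma>" using \<epsilon> by (simp add: r_def \<sigma>_def)
    have "(r k)\<^sup>2 \<le> 1\<^sup>2"
      unfolding r2 using \<epsilon> \<sigma> mult_mono[of \<epsilon> 1 \<sigma> 1] by simp
    then have r1: "r k \<le> 1" by (rule power2_le_imp_le) simp
    have "(\<sigma>\<^sup>2)\<^sup>2 \<le> (r k ^ 3)\<^sup>2"
    proof -
      have "(\<sigma>\<^sup>2)\<^sup>2 = \<sigma> * \<sigma> ^ 3" by (simp add: eval_nat_numeral mult_ac)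
      also have "\<dots> \<le> \<epsilon> ^ 3 * \<sigma> ^ 3"
        using \<sigma> by (intro mult_right_mono) auto
      also have "\<dots> = ((r k)\<^sup>2) ^ 3" by (simp add: r2 power_mult_distrib)
      also have "\<dots> = (r k ^ 3)\<^sup>2" by (simp flip: power_mult)
      finally show ?thesis .
    qed
    then have r3: "\<sigma>\<^sup>2 \<le> r k ^ 3"
      by (rule power2_le_imp_le) (use rpos[of k] in simp)
    obtain z where z: "z \<in> N" "dyadic_cell k z = c" using c by blast
    obtain f G' where f: "C11_bounded M' {u. dyadic_cell k u = c} f G'" "f z = 0"
      "\<And>u. theta3 f G' u = theta3 \<phi> G u" "\<And>u. theta4 f G' u = theta4 \<phi> G u"
      "\<And>n R. ball_cover \<rho> f {u. dyadic_cell k u = c} n R \<Longrightarrow> ball_cover \<rho> \<phi> (N \<inter> {u. dyadic_cell k u = c}) n R"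
      using normalised_cell[OF \<sigma>(3)[unfolded \<sigma>_def] c z(2)] unfolding M'_def by blast
    have AR: "C * (4 * M' * r k) = A * r k" by (simp add: A_def)
    have "ball_cover \<rho> f {u. dyadic_cell k u = c} (2 * (\<sigma> / r k ^ 3) + 2) (C * (4 * M' * r k))"
    proof (rule cover_degree5[OF f(1) box(1) _ f(2) \<sigma>(1,2) _ _ rpos r1 r3])
      show "theta3 f G' z $ 1 * theta4 f G' z $ 2 = theta3 f G' z $ 2 * theta4 f G' z $ 1"
        using par[OF z(1)] by (simp add: f(3,4))
    qed (use z cell_diameter in \<open>auto simp: \<sigma>_def\<close>)
    moreover have "(2 * (\<sigma> / r k ^ 3) + 2) * (A * r k) ^ 5 \<le> \<eta> / 4 ^ k"
    proof -
      have "(2 * (\<sigma> / r k ^ 3) + 2) * (A * r k) ^ 5 = A ^ 5 * (2 * \<sigma> * (r k)\<^sup>2 + 2 * r k ^ 5)"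
        using rpos[of k] by (simp add: power_mult_distrib field_simps eval_nat_numeral)
      also have "\<dots> \<le> A ^ 5 * (4 * \<epsilon> * \<sigma>\<^sup>2)"
      proof (intro mult_left_mono)
        have "r k ^ 5 = r k * ((r k)\<^sup>2)\<^sup>2" by (simp add: eval_nat_numeral mult_ac)
        also have "\<dots> \<le> 1 * (\<epsilon> * \<sigma>)\<^sup>2"
          unfolding r2 using r1 by (intro mult_right_mono) auto
        also have "\<dots> \<le> \<epsilon> * \<sigma>\<^sup>2"
        proof -
          have "\<epsilon>\<^sup>2 \<le> \<epsilon>" using \<epsilon> by (simp add: power2_eq_square mult_left_le)
          from mult_right_mono[OF this, of "\<sigma>\<^sup>2"] show ?thesis by (simp add: power_mult_distrib)
        qed
        finally show "2 * \<sigma> * (r k)\<^sup>2 + 2 * r k ^ 5 \<le> 4 * \<epsilon> * \<sigma>\<^sup>2"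
          unfolding r2 by (simp add: power2_eq_square)
      qed (use M' in auto)
      also have "\<dots> = 16 * A ^ 5 * \<epsilon> / 4 ^ k"
        unfolding \<sigma>2 by simp
      also have "\<dots> \<le> \<eta> / 4 ^ k"
        by (intro divide_right_mono \<epsilon>) simp
      finally show ?thesis .
    qed
    ultimately show ?thesis
      unfolding AR by (blast intro: f(5))
  qed
  then show "\<exists>m k0 K R. \<forall>k\<ge>k0. 0 < R k \<and> R k \<le> \<delta> \<and>
      (\<forall>c\<in>dyadic_cell k ` N. \<exists>n. n * R k ^ 5 \<le> (if c \<in> gap_cells N m k then K else \<eta>) / 4 ^ k \<and>
         ball_cover \<rho> \<phi> (N \<inter> {u. dyadic_cell k u = c}) n (R k))"
    using k0 rpos M' by (intro exI[of _ 0] exI[of _ k0] exI[of _ \<eta>] exI[of _ "\<lambda>k. A * r k"]) (auto simp: less_imp_le)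
qed

end

section \<open>Degree and tangent planes\<close>

lemma engel_coords_nth:
  "engel_coords x v $ 1 = v$1" "engel_coords x v $ 2 = v$2"
  "engel_coords x v $ 3 = v$3 - x$1 * v$2"
  "engel_coords x v $ 4 = v$4 - x$1 * v$3 + (x$1)\<^sup>2 / 2 * v$2"
  using iffD1[OF engel_frame_expansion engel_coords_expansion[of v x]] by auto

lemma engel_coords_combination:
  "engel_coords x (a *\<^sub>R v + b *\<^sub>R w) = a *\<^sub>R engel_coords x v + b *\<^sub>R engel_coords x w"
  by (simp add: vec_eq_iff forall_4 engel_coords_nth algebra_simps)

lemma engel_coords_eq_0:
  assumes "engel_coords x v = 0"
  shows "v = 0"
  using engel_coords_expansion[of v x] by (simp add: assms)

lemma independent_pair_combination:
  fixes v w :: "'a::real_vector"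
  assumes "independent {v, w}" "v \<noteq> w" "p *\<^sub>R v + q *\<^sub>R w = 0"
  shows "p = 0" "q = 0"
proof -
  define c where "c x = (if x = v then p else q)" for x
  have "(\<Sum>x\<in>{v, w}. c x *\<^sub>R x) = 0" using assms by (simp add: c_def)
  then have "c x = 0" if "x \<in> {v, w}" for x
    using real_vector.independentD[OF assms(1), of "{v, w}" c x] that by blast
  from this[of v] this[of w] show "p = 0" "q = 0" using assms(2) by (auto simp: c_def)
qed

lemma wedge_coeff_combination:
  "wedge_coeff x (a *\<^sub>R v + b *\<^sub>R w) (c *\<^sub>R v + d *\<^sub>R w) i j = (a * d - b * c) * wedge_coeff x v w i j"
  by (simp add: wedge_coeff_def engel_coords_combination algebra_simps)

text \<open>
  If \<open>p\<close> and \<open>q\<close> are the coefficients of \<open>v\<close> and \<open>w\<close> at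
  \<open>X\<^sub>i\<close>, then the vanishing wedge coefficients are the coordinates of \<open>q v - p
  w\<close>, so independence forces \<open>p = q = 0\<close>.
\<close>

lemma wedge_coeff_row_eq_0:
  assumes ind: "independent {v, w}" "v \<noteq> w" and 0: "\<And>j. wedge_coeff x v w i j = 0"
  shows "engel_coords x v $ i = 0" "engel_coords x w $ i = 0"
proof -
  let ?p = "engel_coords x v $ i" and ?q = "engel_coords x w $ i"
  have "engel_coords x (?q *\<^sub>R v + (- ?p) *\<^sub>R w) = 0"
    unfolding engel_coords_combination using 0 by (simp add: vec_eq_iff wedge_coeff_def algebra_simps)
  then have "?q *\<^sub>R v + (- ?p) *\<^sub>R w = 0" by (rule engel_coords_eq_0)
  from independent_pair_combination[OF ind this] show "?p = 0" "?q = 0" by auto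
qed

lemma wedge_weights_bounds:
  assumes "wedge_coeff x v w i j \<noteq> 0"
  shows "engel_weight i + engel_weight j \<in> {2..5}"
proof -
  have "i \<noteq> j" using assms by (auto simp: wedge_coeff_def)
  moreover have "\<forall>i j. i \<noteq> j \<longrightarrow> engel_weight i + engel_weight j \<in> {2..5}"
    unfolding forall_4 by (simp add: engel_weight_def)
  ultimately show ?thesis by blast
qed

lemma finite_wedge_weights: "finite {engel_weight i + engel_weight j | i j. wedge_coeff x v w i j \<noteq> 0}"
proof (rule finite_subset)
  show "{engel_weight i + engel_weight j | i j. wedge_coeff x v w i j \<noteq> 0} \<subseteq> {2..5}"
    using wedge_weights_bounds by blast
qed simp

lemma wedge_degree_bounds:
  assumes "independent {v, w}" "v \<noteq> w"
  shows "wedge_degree x v w \<in> {2..5}"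
proof -
  let ?W = "{engel_weight i + engel_weight j | i j. wedge_coeff x v w i j \<noteq> 0}"
  have "?W \<noteq> {}"
  proof
    assume "?W = {}"
    then have "wedge_coeff x v w i j = 0" for i j by blast
    then have "engel_coords x v = 0"
      using wedge_coeff_row_eq_0[OF assms] by (simp add: vec_eq_iff)
    then have "v = 0" by (rule engel_coords_eq_0)
    then show False using assms(1) dependent_zero by blast
  qed
  then have "wedge_degree x v w \<in> ?W"
    unfolding wedge_degree_def by (rule Max_in[OF finite_wedge_weights])
  then obtain i j where "wedge_degree x v w = engel_weight i + engel_weight j" "wedge_coeff x v w i j \<noteq> 0"
    by blast
  then show ?thesis using wedge_weights_bounds[of x v w i j] by simp
qed

lemma wedge_coeff_eq_0_above_degree:
  assumes "wedge_degree x v w < engel_weight i + engel_weight j"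
  shows "wedge_coeff x v w i j = 0"
proof (rule ccontr)
  assume "wedge_coeff x v w i j \<noteq> 0"
  then have "engel_weight i + engel_weight j \<le> wedge_degree x v w"
    unfolding wedge_degree_def by (intro Max_ge finite_wedge_weights) blast
  with assms show False by simp
qed

lemma wedge_degree_change_basis:
  fixes v w v' w' :: "real^4"
  assumes ind': "independent {v', w'}" "v' \<noteq> w'"
    and span: "span {v', w'} \<subseteq> span {v, w}"
  shows "wedge_degree x v' w' = wedge_degree x v w"
proof -
  have "\<exists>a b. y = a *\<^sub>R v + b *\<^sub>R w" if "y \<in> span {v, w}" for y
  proof -
    have "\<exists>a. y - a *\<^sub>R v \<in> span {w}"
      using that by (simp add: span_insert)
    then obtain a b where "y - a *\<^sub>R v = b *\<^sub>R w" unfolding span_singleton by blast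
    then have "y = a *\<^sub>R v + b *\<^sub>R w" by (simp add: algebra_simps)
    then show ?thesis by blast
  qed
  then obtain a b c d where ab: "v' = a *\<^sub>R v + b *\<^sub>R w" and cd: "w' = c *\<^sub>R v + d *\<^sub>R w"
    using span span_superset[of "{v', w'}"] by (meson insert_subset subset_trans)
  have "a * d - b * c \<noteq> 0"
  proof
    assume det: "a * d - b * c = 0"
    have "d *\<^sub>R v' + (- b) *\<^sub>R w' = (a * d - b * c) *\<^sub>R v"
      "c *\<^sub>R v' + (- a) *\<^sub>R w' = (b * c - a * d) *\<^sub>R w"
      by (simp_all add: ab cd algebra_simps)
    then have "d *\<^sub>R v' + (- b) *\<^sub>R w' = 0" "c *\<^sub>R v' + (- a) *\<^sub>R w' = 0"
      using det by auto
    then have "- a = 0" "- b = 0"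
      using independent_pair_combination(2)[OF ind'] by blast+
    then have "a = 0" "b = 0" by simp_all
    then have "v' = 0" by (simp add: ab)
    then show False using ind'(1) dependent_zero by blast
  qed
  then have "wedge_coeff x v' w' i j \<noteq> 0 \<longleftrightarrow> wedge_coeff x v w i j \<noteq> 0" for i j
    by (simp add: ab cd wedge_coeff_combination)
  then show ?thesis by (simp add: wedge_degree_def)
qed

lemma pointwise_degree_eqI:
  assumes "independent {v, w}" "v \<noteq> w" "span {v, w} = tangent_space S x"
  shows "pointwise_degree S x = wedge_degree x v w"
  unfolding pointwise_degree_def
proof (rule the_equality)
  show "\<exists>v' w'. v' \<noteq> w' \<and> independent {v', w'} \<and> span {v', w'} = tangent_space S x \<and>
      wedge_degree x v w = wedge_degree x v' w'"
    using assms by blast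
  fix n assume "\<exists>v' w'. v' \<noteq> w' \<and> independent {v', w'} \<and> span {v', w'} = tangent_space S x \<and>
      n = wedge_degree x v' w'"
  then obtain v' w' where vw': "independent {v', w'}" "v' \<noteq> w'" "span {v', w'} = tangent_space S x"
      and n: "n = wedge_degree x v' w'"
    by blast
  have "span {v', w'} \<subseteq> span {v, w}" using assms(3) vw'(3) by simp
  then show "n = wedge_degree x v w"
    unfolding n by (rule wedge_degree_change_basis[OF vw'(1,2)])
qed

text \<open>
  The inclusion from left to right needs the homeomorphism property: it turns a curve in the surface into a
  continuous curve \<open>c\<close> of parameters, and injectivity of \<open>D\<close> bounds the speed of
  \<open>c\<close>. The difference quotients of \<open>c\<close> are then mapped by \<open>D\<close> close to
  the tangent vector, and the range of \<open>D\<close> is closed.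
\<close>

lemma tangent_space_parametrized:
  fixes \<phi> :: "real^2 \<Rightarrow> real^4"
  assumes V: "open V" "u \<in> V" and op: "openin (top_of_set S) (\<phi> ` V)"
    and hom: "homeomorphism V (\<phi> ` V) \<phi> \<psi>"
    and der: "(\<phi> has_derivative D) (at u)" and inj: "inj D"
  shows "tangent_space S (\<phi> u) = range D"
proof
  have lin: "linear D" and bl: "bounded_linear D"
    using der has_derivative_linear has_derivative_bounded_linear by blast+
  have sub: "\<phi> ` V \<subseteq> S" using op openin_imp_subset by blast
  show "range D \<subseteq> tangent_space S (\<phi> u)"
  proof
    fix y assume "y \<in> range D"
    then obtain h where h: "y = D h" by blast
    have line: "((\<lambda>t. u + t *\<^sub>R h) has_derivative (\<lambda>t. t *\<^sub>R h)) (at 0)"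
      by (auto intro!: derivative_eq_intros)
    have "((\<lambda>t. \<phi> (u + t *\<^sub>R h)) has_derivative (\<lambda>t. D (t *\<^sub>R h))) (at 0)"
      by (rule has_derivative_compose[OF line]) (simp add: der)
    then have "((\<lambda>t. \<phi> (u + t *\<^sub>R h)) has_vector_derivative y) (at 0)"
      by (simp add: has_vector_derivative_def linear_scale[OF lin] h)
    moreover have "\<forall>\<^sub>F t in nhds 0. \<phi> (u + t *\<^sub>R h) \<in> S"
    proof -
      have "((\<lambda>t. u + t *\<^sub>R h) \<longlongrightarrow> u + 0 *\<^sub>R h) (nhds 0)"
        by (intro tendsto_intros filterlim_ident)
      then have "\<forall>\<^sub>F t in nhds 0. u + t *\<^sub>R h \<in> V"
        using V by (intro topological_tendstoD) auto
      then show ?thesis by eventually_elim (use sub in blast)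
    qed
    ultimately show "y \<in> tangent_space S (\<phi> u)"
      unfolding tangent_space_def by (intro CollectI exI[of _ "\<lambda>t. \<phi> (u + t *\<^sub>R h)"]) simp
  qed
  show "tangent_space S (\<phi> u) \<subseteq> range D"
  proof
    fix y assume "y \<in> tangent_space S (\<phi> u)"
    then obtain \<gamma> where \<gamma>: "\<gamma> 0 = \<phi> u" "\<forall>\<^sub>F t in nhds 0. \<gamma> t \<in> S"
        and \<gamma>': "(\<gamma> has_vector_derivative y) (at 0)"
      unfolding tangent_space_def by blast
    obtain W where W: "open W" "\<phi> ` V = S \<inter> W"
      using op openin_open by blast
    have cont: "isCont \<gamma> 0"
      using \<gamma>' has_derivative_continuous unfolding has_vector_derivative_def by blast
    then have \<gamma>0: "(\<gamma> \<longlongrightarrow> \<phi> u) (at 0)" using \<gamma>(1) by (simp add: isCont_def)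
    have "\<phi> u \<in> W" using W V by blast
    then have "\<forall>\<^sub>F t in at 0. \<gamma> t \<in> W"
      using topological_tendstoD[OF \<gamma>0 W(1)] by blast
    moreover have "\<forall>\<^sub>F t in at 0. \<gamma> t \<in> S"
      using \<gamma>(2) by (simp add: eventually_nhds_conv_at)
    ultimately have ev: "\<forall>\<^sub>F t in at 0. \<gamma> t \<in> \<phi> ` V"
      unfolding W(2) by eventually_elim blast
    have "continuous_on (\<phi> ` V) \<psi>" and \<psi>: "\<And>z. z \<in> V \<Longrightarrow> \<psi> (\<phi> z) = z"
      using hom unfolding homeomorphism_def by auto
    then have "((\<lambda>t. \<psi> (\<gamma> t)) \<longlongrightarrow> \<psi> (\<phi> u)) (at 0)"
      using continuous_on_tendsto_compose[OF _ \<gamma>0 _ ev] V by blast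
    define c where "c t = \<psi> (\<gamma> t)" for t
    have c0: "(c \<longlongrightarrow> u) (at 0)" using \<open>((\<lambda>t. \<psi> (\<gamma> t)) \<longlongrightarrow> \<psi> (\<phi> u)) (at 0)\<close> \<psi>[OF V(2)]
      unfolding c_def by simp
    have \<phi>c: "\<forall>\<^sub>F t in at 0. \<phi> (c t) = \<gamma> t"
      using ev by eventually_elim (auto simp: c_def \<psi>)
    obtain B where B: "B > 0" "\<And>h. B * norm h \<le> norm (D h)"
      using linear_inj_bounded_below_pos[OF lin inj] by blast
    have quot: "((\<lambda>t. norm (\<gamma> t - \<phi> u - t *\<^sub>R y) / norm t) \<longlongrightarrow> 0) (at 0)"
      using \<gamma>' \<gamma>(1) by (simp add: has_vector_derivative_def has_derivative_at)
    have "y \<in> closure (range D)"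
      unfolding closure_approachable
    proof (intro allI impI)
      fix \<epsilon> :: real assume \<epsilon>: "\<epsilon> > 0"
      define K where "K = 2 * (norm y + 1) / B"
      have K: "K > 0" using B by (simp add: K_def add_nonneg_pos)
      \<comment> \<open>\<open>K \<bar>t\<bar>\<close> will bound the parameter displacement \<open>h\<close>: half of the lower bound \<open>B\<close> for \<open>D\<close> is
        given up to absorb the first order error of \<open>\<phi>\<close>.\<close>
      define \<epsilon>' where "\<epsilon>' = min (B / 2) (\<epsilon> / (2 * K))"
      have "\<epsilon>' \<le> B / 2" by (simp add: \<epsilon>'_def)
      have \<epsilon>': "\<epsilon>' > 0" using B K \<epsilon> by (simp add: \<epsilon>'_def)
      obtain s where s: "s > 0" "\<And>z. norm (z - u) < s \<Longrightarrow> norm (\<phi> z - \<phi> u - D (z - u)) \<le> \<epsilon>' * norm (z - u)"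
        using der \<epsilon>' unfolding has_derivative_at_alt by blast
      have "\<forall>\<^sub>F t in at 0. dist (c t) u < s"
        using tendstoD[OF c0 s(1)] .
      moreover have "\<forall>\<^sub>F t in at 0. norm (\<gamma> t - \<phi> u - t *\<^sub>R y) / norm t < min 1 (\<epsilon> / 2)"
        using \<epsilon> by (intro order_tendstoD(2)[OF quot]) auto
      moreover have "\<forall>\<^sub>F t in at 0. t \<noteq> (0 :: real)"
        by (simp add: eventually_at_filter)
      ultimately have "\<forall>\<^sub>F t in at 0. dist (c t) u < s \<and>
          norm (\<gamma> t - \<phi> u - t *\<^sub>R y) / norm t < min 1 (\<epsilon> / 2) \<and> t \<noteq> 0 \<and> \<phi> (c t) = \<gamma> t"
        using \<phi>c by (intro eventually_conj)
      then obtain t where t: "norm (c t - u) < s" "norm (\<gamma> t - \<phi> u - t *\<^sub>R y) / norm t < min 1 (\<epsilon> / 2)"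
          "t \<noteq> 0" "\<phi> (c t) = \<gamma> t"
        using eventually_happens'[OF at_neq_bot] unfolding dist_norm by blast
      define h where "h = c t - u"
      have r1: "norm (\<gamma> t - \<phi> u - D h) \<le> \<epsilon>' * norm h"
        using s(2)[OF t(1)] t(4) by (simp add: h_def)
      have r2: "norm (\<gamma> t - \<phi> u - t *\<^sub>R y) \<le> 1 * \<bar>t\<bar>" "norm (\<gamma> t - \<phi> u - t *\<^sub>R y) < \<epsilon> / 2 * \<bar>t\<bar>"
        using t(2,3) by (simp_all add: pos_divide_less_eq)
      have hK: "norm h \<le> K * \<bar>t\<bar>"
      proof -
        have "B * norm h \<le> norm (D h)" by (rule B(2))
        also have "\<dots> \<le> norm (\<gamma> t - \<phi> u - D h) + norm (\<gamma> t - \<phi> u - t *\<^sub>R y) + norm (t *\<^sub>R y)"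
          using norm_triangle_ineq4[of "(\<gamma> t - \<phi> u - t *\<^sub>R y) + t *\<^sub>R y" "\<gamma> t - \<phi> u - D h"]
            norm_triangle_ineq[of "\<gamma> t - \<phi> u - t *\<^sub>R y" "t *\<^sub>R y"] by simp
        also have "\<dots> \<le> B / 2 * norm h + 1 * \<bar>t\<bar> + norm y * \<bar>t\<bar>"
        proof (intro add_mono)
          show "norm (\<gamma> t - \<phi> u - D h) \<le> B / 2 * norm h"
            using r1 mult_right_mono[OF \<open>\<epsilon>' \<le> B / 2\<close> norm_ge_zero[of h]] by linarith
        qed (use r2 in simp_all)
        finally have "B / 2 * norm h \<le> (norm y + 1) * \<bar>t\<bar>" by (simp add: algebra_simps)
        then show ?thesis using B(1) by (simp add: K_def field_simps)
      qed
      have "norm (D h - t *\<^sub>R y) \<le> norm (\<gamma> t - \<phi> u - t *\<^sub>R y) + norm (\<gamma> t - \<phi> u - D h)"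
        using norm_triangle_ineq4[of "\<gamma> t - \<phi> u - t *\<^sub>R y" "\<gamma> t - \<phi> u - D h"] by simp
      also have "\<dots> < \<epsilon> * \<bar>t\<bar>"
      proof -
        have "\<epsilon>' * norm h \<le> \<epsilon> / (2 * K) * (K * \<bar>t\<bar>)"
          using hK K \<epsilon> by (intro mult_mono) (auto simp: \<epsilon>'_def)
        then show ?thesis using r1 r2 K by simp
      qed
      finally have *: "norm (D h - t *\<^sub>R y) < \<epsilon> * \<bar>t\<bar>" .
      have "norm (D ((1 / t) *\<^sub>R h) - y) = norm ((1 / t) *\<^sub>R (D h - t *\<^sub>R y))"
        using t(3) by (simp add: linear_scale[OF lin] scaleR_diff_right)
      also have "\<dots> = norm (D h - t *\<^sub>R y) / \<bar>t\<bar>" by simp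
      also have "\<dots> < \<epsilon>" using * t(3) by (simp add: divide_less_eq)
      finally show "\<exists>x\<in>range D. dist x y < \<epsilon>" by (auto simp: dist_norm)
    qed
    moreover have "closed (range D)"
      using closed_subspace linear_subspace_image[OF lin subspace_UNIV] by blast
    ultimately show "y \<in> range D" by simp
  qed
qed

text \<open>
  Translates the geometric data into the analytic setting: near a point the coordinates of the parametrization
  are uniformly controlled, and the degree is computed from the partial derivatives, whose coefficients at
  \<open>X\<^sub>3\<close> and \<open>X\<^sub>4\<close> are the entries of the pulled back forms.
\<close>

lemma C11_parametrization_chart:
  assumes par: "C11_parametrization S V \<phi>" and u0: "u0 \<in> V"
  obtains r M G where "r > 0" "C11_bounded M (cball u0 r) \<phi> G"
    "\<And>u. u \<in> cball u0 r \<Longrightarrow> \<bar>\<phi> u $ 1\<bar> \<le> M"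
    "\<And>U. open U \<Longrightarrow> U \<subseteq> cball u0 r \<Longrightarrow> openin (top_of_set S) (\<phi> ` U)"
    "\<And>u. u \<in> cball u0 r \<Longrightarrow> \<exists>v w. independent {v, w} \<and> v \<noteq> w \<and> pointwise_degree S (\<phi> u) = wedge_degree (\<phi> u) v w \<and>
       theta3 \<phi> G u = vector [engel_coords (\<phi> u) v $ 3, engel_coords (\<phi> u) w $ 3] \<and>
       theta4 \<phi> G u = vector [engel_coords (\<phi> u) v $ 4, engel_coords (\<phi> u) w $ 4]"
proof -
  obtain \<psi> \<phi>' where V: "open V" and op: "openin (top_of_set S) (\<phi> ` V)"
    and hom: "homeomorphism V (\<phi> ` V) \<phi> \<psi>"
    and der: "\<And>u. u \<in> V \<Longrightarrow> (\<phi> has_derivative blinfun_apply (\<phi>' u)) (at u)"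
    and inj: "\<And>u. u \<in> V \<Longrightarrow> inj (blinfun_apply (\<phi>' u))"
    and lip: "\<And>u. u \<in> V \<Longrightarrow> \<exists>e>0. \<exists>L. L-lipschitz_on (ball u e \<inter> V) \<phi>'"
    using par unfolding C11_parametrization_def by blast
  obtain e1 where e1: "e1 > 0" "ball u0 e1 \<subseteq> V"
    using V u0 openE by blast
  obtain e2 L where e2: "e2 > 0" "L-lipschitz_on (ball u0 e2 \<inter> V) \<phi>'"
    using lip[OF u0] by blast
  define r where "r = min e1 e2 / 2"
  have r: "r > 0" using e1 e2 by (simp add: r_def)
  have B: "cball u0 r \<subseteq> ball u0 e2 \<inter> V" "cball u0 r \<subseteq> V"
  proof -
    have "cball u0 r \<subseteq> ball u0 e1" "cball u0 r \<subseteq> ball u0 e2"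
      using e1 e2 by (auto simp: r_def)
    then show "cball u0 r \<subseteq> ball u0 e2 \<inter> V" "cball u0 r \<subseteq> V" using e1(2) by blast+
  qed
  have L: "0 \<le> L" using e2(2) lipschitz_on_nonneg by blast
  have \<phi>'lip: "norm (\<phi>' u - \<phi>' v) \<le> L * norm (u - v)" if "u \<in> cball u0 r" "v \<in> cball u0 r" for u v
    using lipschitz_onD[OF e2(2)] that B(1) by (metis dist_norm subsetD)
  have "continuous_on (cball u0 r) \<phi>"
    by (rule continuous_on_subset[OF homeomorphism_cont1[OF hom] B(2)])
  then have "bounded (\<phi> ` cball u0 r)"
    by (intro compact_imp_bounded compact_continuous_image compact_cball)
  then obtain P where P: "\<And>u. u \<in> cball u0 r \<Longrightarrow> norm (\<phi> u) \<le> P"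
    unfolding bounded_iff by blast
  define G where "G i u = (vector [\<phi>' u (axis 1 1) $ i, \<phi>' u (axis 2 1) $ i] :: real^2)" for i u
  define K where "K = norm (\<phi>' u0) + L * r"
  have K: "norm (\<phi>' u) \<le> K" if u: "u \<in> cball u0 r" for u
  proof -
    have "norm (\<phi>' u) \<le> norm (\<phi>' u0) + norm (\<phi>' u - \<phi>' u0)"
      using norm_triangle_ineq[of "\<phi>' u0" "\<phi>' u - \<phi>' u0"] by simp
    also have "norm (\<phi>' u - \<phi>' u0) \<le> L * norm (u - u0)"
      using r by (intro \<phi>'lip u) simp
    also have "\<dots> \<le> L * r"
      using u L by (intro mult_left_mono) (auto simp: dist_norm norm_minus_commute)
    finally show ?thesis by (simp add: K_def)
  qed
  have comp: "norm (vector [T (axis 1 1) $ i, T (axis 2 1) $ i] :: real^2) \<le> 2 * norm T"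
    for T :: "(real^2) \<Rightarrow>\<^sub>L (real^4)" and i
  proof -
    have "\<bar>T (axis j 1) $ i\<bar> \<le> norm T" for j :: 2
      using component_le_norm_cart[of "T (axis j 1)" i] norm_blinfun[of T "axis j 1"] by (simp add: norm_axis_1)
    from this[of 1] this[of 2] show ?thesis
      using norm_le_l1_cart[of "vector [T (axis 1 1) $ i, T (axis 2 1) $ i] :: real^2"] by (simp add: sum_2 vector_2)
  qed
  define M where "M = max 1 (max P (max (2 * K) (2 * L)))"
  have M: "1 \<le> M" "P \<le> M" "2 * K \<le> M" "2 * L \<le> M" by (auto simp: M_def)
  have grad: "\<phi>' u h $ i = G i u \<bullet> h" for u h i
  proof -
    have "h = h$1 *\<^sub>R axis 1 1 + h$2 *\<^sub>R axis 2 1"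
      by (simp add: vec_eq_iff forall_2 axis_def)
    then have "\<phi>' u h = h$1 *\<^sub>R \<phi>' u (axis 1 1) + h$2 *\<^sub>R \<phi>' u (axis 2 1)"
      by (metis blinfun.add_right blinfun.scaleR_right)
    then show ?thesis by (simp add: G_def inner_vec_def sum_2 vector_2 mult.commute)
  qed
  have "C11_bounded M (cball u0 r) \<phi> G"
    unfolding C11_bounded_def
  proof (intro conjI allI ballI convex_cball M(1))
    fix i u assume u: "u \<in> cball u0 r"
    have "((\<lambda>u. \<phi> u $ i) has_derivative (\<lambda>h. \<phi>' u h $ i)) (at u)"
      using u B(2) by (intro bounded_linear.has_derivative[OF bounded_linear_vec_nth] der) blast
    then show "((\<lambda>u. \<phi> u $ i) has_derivative (\<lambda>h. G i u \<bullet> h)) (at u within cball u0 r)"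
      unfolding grad by (rule has_derivative_at_withinI)
    show "norm (G i u) \<le> M"
      using comp[of "\<phi>' u" i] K[OF u] M(3) by (simp add: G_def)
    fix v assume v: "v \<in> cball u0 r"
    have "norm (G i u - G i v) \<le> 2 * norm (\<phi>' u - \<phi>' v)"
    proof -
      have "G i u - G i v = vector [(\<phi>' u - \<phi>' v) (axis 1 1) $ i, (\<phi>' u - \<phi>' v) (axis 2 1) $ i]"
        by (simp add: G_def vec_eq_iff forall_2 vector_2 blinfun.diff_left)
      then show ?thesis using comp by simp
    qed
    also have "\<dots> \<le> 2 * (L * norm (u - v))" using \<phi>'lip[OF u v] by simp
    also have "\<dots> \<le> M * norm (u - v)" using mult_right_mono[OF M(4), of "norm (u - v)"] by simp
    finally show "norm (G i u - G i v) \<le> M * norm (u - v)" .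
  qed
  moreover have "\<bar>\<phi> u $ 1\<bar> \<le> M" if "u \<in> cball u0 r" for u
    using component_le_norm_cart[of "\<phi> u" 1] P[OF that] M(2) by linarith
  moreover have "openin (top_of_set S) (\<phi> ` U)" if U: "open U" "U \<subseteq> cball u0 r" for U
  proof -
    have "openin (top_of_set V) U"
      using U B(2) by (auto intro: open_subset)
    then have "openin (top_of_set (\<phi> ` V)) (\<phi> ` U)"
      by (rule homeomorphism_imp_open_map[OF hom])
    then show ?thesis using op openin_trans by blast
  qed
  moreover have "\<exists>v w. independent {v, w} \<and> v \<noteq> w \<and> pointwise_degree S (\<phi> u) = wedge_degree (\<phi> u) v w \<and>
       theta3 \<phi> G u = vector [engel_coords (\<phi> u) v $ 3, engel_coords (\<phi> u) w $ 3] \<and>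
       theta4 \<phi> G u = vector [engel_coords (\<phi> u) v $ 4, engel_coords (\<phi> u) w $ 4]"
    if "u \<in> cball u0 r" for u
  proof (intro exI conjI)
    have u: "u \<in> V" using that B(2) by blast
    have lin: "linear (blinfun_apply (\<phi>' u))"
      by (rule bounded_linear.linear[OF blinfun.bounded_linear_right])
    have basis: "{axis 1 1, axis 2 1} = (Basis :: (real^2) set)"
      by (auto simp: Basis_vec_def UNIV_2)
    let ?v = "\<phi>' u (axis 1 1)" and ?w = "\<phi>' u (axis 2 1)"
    have ne: "axis 1 1 \<noteq> (axis 2 1 :: real^2)" by (simp add: axis_eq_axis)
    show vw: "?v \<noteq> ?w" using inj[OF u] ne by (auto dest: injD)
    have "independent (blinfun_apply (\<phi>' u) ` {axis 1 1, axis 2 1})"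
      unfolding basis using inj[OF u]
      by (intro linear_independent_injective_image lin independent_Basis) (auto intro: inj_on_subset)
    then show ind: "independent {?v, ?w}" by simp
    have "span (blinfun_apply (\<phi>' u) ` {axis 1 1, axis 2 1}) = range (blinfun_apply (\<phi>' u))"
      unfolding basis linear_span_image[OF lin] by simp
    then have "span {?v, ?w} = tangent_space S (\<phi> u)"
      using tangent_space_parametrized[OF V u op hom der[OF u] inj[OF u]] by simp
    then show "pointwise_degree S (\<phi> u) = wedge_degree (\<phi> u) ?v ?w"
      by (rule pointwise_degree_eqI[OF ind vw])
    show "theta3 \<phi> G u = vector [engel_coords (\<phi> u) ?v $ 3, engel_coords (\<phi> u) ?w $ 3]"
      "theta4 \<phi> G u = vector [engel_coords (\<phi> u) ?v $ 4, engel_coords (\<phi> u) ?w $ 4]"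
      by (simp_all add: theta3_def theta4_def G_def vec_eq_iff forall_2 vector_2 engel_coords_nth)
  qed
  ultimately show thesis using that[OF r] by blast
qed

lemma pointwise_degree_range:
  assumes "C11_surface S" "x \<in> S"
  shows "pointwise_degree S x \<in> {2..5}"
proof -
  obtain V \<phi> u where par: "C11_parametrization S V \<phi>" "u \<in> V" and x: "x = \<phi> u"
    using assms unfolding C11_surface_def by blast
  show ?thesis
  proof (rule C11_parametrization_chart[OF par])
    fix r :: real and M G
    assume "r > 0" and "\<And>z. z \<in> cball u r \<Longrightarrow> \<exists>v w. independent {v, w} \<and> v \<noteq> w \<and>
       pointwise_degree S (\<phi> z) = wedge_degree (\<phi> z) v w \<and>
       theta3 \<phi> G z = vector [engel_coords (\<phi> z) v $ 3, engel_coords (\<phi> z) w $ 3] \<and>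
       theta4 \<phi> G z = vector [engel_coords (\<phi> z) v $ 4, engel_coords (\<phi> z) w $ 4]"
    from this(2)[of u] this(1) obtain v w where "independent {v, w}" "v \<noteq> w" "pointwise_degree S x = wedge_degree x v w"
      unfolding x by auto
    then show "pointwise_degree S x \<in> {2..5}" using wedge_degree_bounds by metis
  qed
qed

section \<open>Negligibility of the points of low degree\<close>

text \<open>
  The weights 1, 1, 2, 3 translate degree less than \<open>d\<close> into equations: all coefficients involving
  \<open>X\<^sub>4\<close> vanish if \<open>d \<le> 4\<close>, those involving \<open>X\<^sub>3\<close> vanish
  as well if \<open>d = 3\<close>, and the coefficient at \<open>X\<^sub>3 \<and> X\<^sub>4\<close> vanishes if
  \<open>d \<le> 5\<close>.
\<close>

lemma low_degree_points_locally_small: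
  assumes hom: "homogeneous_distance \<rho>" and S: "C11_surface S" and x: "x \<in> S" and d: "d \<in> {3..5}"
  obtains W where "openin (top_of_set S) W" "x \<in> W"
    "has_small_covers \<rho> d (W \<inter> {y \<in> S. pointwise_degree S y < d})"
proof -
  obtain V \<phi> u0 where par: "C11_parametrization S V \<phi>" and u0: "u0 \<in> V" "x = \<phi> u0"
    using S x unfolding C11_surface_def by blast
  obtain r M G where r: "r > 0" and C11: "C11_bounded M (cball u0 r) \<phi> G"
    and bd: "\<And>u. u \<in> cball u0 r \<Longrightarrow> \<bar>\<phi> u $ 1\<bar> \<le> M"
    and op: "\<And>U. open U \<Longrightarrow> U \<subseteq> cball u0 r \<Longrightarrow> openin (top_of_set S) (\<phi> ` U)"
    and deg: "\<And>u. u \<in> cball u0 r \<Longrightarrow> \<exists>v w. independent {v, w} \<and> v \<noteq> w \<and>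
       pointwise_degree S (\<phi> u) = wedge_degree (\<phi> u) v w \<and>
       theta3 \<phi> G u = vector [engel_coords (\<phi> u) v $ 3, engel_coords (\<phi> u) w $ 3] \<and>
       theta4 \<phi> G u = vector [engel_coords (\<phi> u) v $ 4, engel_coords (\<phi> u) w $ 4]"
    using C11_parametrization_chart[OF par u0(1)] by blast
  obtain C where C: "C \<ge> 1" "box_bound \<rho> C"
    using homogeneous_distance_box_bound[OF hom] by blast
  have inv: "\<rho> (engel_mult q x) (engel_mult q y) = \<rho> x y" for q x y
    using hom unfolding homogeneous_distance_def by blast
  define N where "N = {u \<in> ball u0 (r / 2). pointwise_degree S (\<phi> u) < d}"
  have N: "bounded N"
    by (rule bounded_subset[OF bounded_ball[of u0 "r / 2"]]) (auto simp: N_def)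
  have margin: "v \<in> cball u0 r" if "u \<in> N" "norm (v - u) \<le> r / 2" for u v
    using that norm_triangle_ineq[of "v - u" "u - u0"] by (simp add: N_def dist_norm norm_minus_commute)
  have half: "0 < r / 2" using r by simp
  have th4: "theta4 \<phi> G u = 0" if u: "u \<in> N" and d4: "d \<le> 4" for u
  proof -
    obtain v w where vw: "independent {v, w}" "v \<noteq> w" "wedge_degree (\<phi> u) v w < d"
       "theta4 \<phi> G u = vector [engel_coords (\<phi> u) v $ 4, engel_coords (\<phi> u) w $ 4]"
      using deg[of u] margin[OF u, of u] u r unfolding N_def by force
    have "\<forall>j. wedge_coeff (\<phi> u) v w 4 j = 0"
      unfolding forall_4 using vw(3) d4
      by (auto intro!: wedge_coeff_eq_0_above_degree simp: engel_weight_def)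
    then show ?thesis
      using wedge_coeff_row_eq_0[OF vw(1,2)] by (simp add: vw(4) vec_eq_iff forall_2 vector_2)
  qed
  have th3: "theta3 \<phi> G u = 0" if u: "u \<in> N" and d3: "d \<le> 3" for u
  proof -
    obtain v w where vw: "independent {v, w}" "v \<noteq> w" "wedge_degree (\<phi> u) v w < d"
       "theta3 \<phi> G u = vector [engel_coords (\<phi> u) v $ 3, engel_coords (\<phi> u) w $ 3]"
      using deg[of u] margin[OF u, of u] u r unfolding N_def by force
    have "\<forall>j. wedge_coeff (\<phi> u) v w 3 j = 0"
      unfolding forall_4 using vw(3) d3
      by (auto intro!: wedge_coeff_eq_0_above_degree simp: engel_weight_def)
    then show ?thesis
      using wedge_coeff_row_eq_0[OF vw(1,2)] by (simp add: vw(4) vec_eq_iff forall_2 vector_2)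
  qed
  have th34: "theta3 \<phi> G u $ 1 * theta4 \<phi> G u $ 2 = theta3 \<phi> G u $ 2 * theta4 \<phi> G u $ 1" if u: "u \<in> N" for u
  proof -
    obtain v w where vw: "wedge_degree (\<phi> u) v w < d"
       "theta3 \<phi> G u = vector [engel_coords (\<phi> u) v $ 3, engel_coords (\<phi> u) w $ 3]"
       "theta4 \<phi> G u = vector [engel_coords (\<phi> u) v $ 4, engel_coords (\<phi> u) w $ 4]"
      using deg[of u] margin[OF u, of u] u r unfolding N_def by force
    have "wedge_coeff (\<phi> u) v w 3 4 = 0"
      using vw(1) d by (intro wedge_coeff_eq_0_above_degree) (simp add: engel_weight_def)
    then show ?thesis by (simp add: vw(2,3) vector_2 wedge_coeff_def mult.commute)
  qed
  consider "d = 3" | "d = 4" | "d = 5" using d by force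
  then have "has_small_covers \<rho> d (\<phi> ` N)"
  proof cases
    case 1
    then show ?thesis
      using has_small_covers_degree3[OF inv C(2,1) C11 bd half margin N] th3 th4 by simp
  next
    case 2
    then show ?thesis
      using has_small_covers_degree4[OF inv C(2,1) C11 bd half margin N] th4 by simp
  next
    case 3
    then show ?thesis
      using has_small_covers_degree5[OF inv C(2,1) C11 bd half margin N] th34 by simp
  qed
  moreover have "\<phi> ` ball u0 (r / 2) \<inter> {y \<in> S. pointwise_degree S y < d} \<subseteq> \<phi> ` N"
    by (auto simp: N_def)
  ultimately have "has_small_covers \<rho> d (\<phi> ` ball u0 (r / 2) \<inter> {y \<in> S. pointwise_degree S y < d})"
    by (rule has_small_covers_subset)
  moreover have "openin (top_of_set S) (\<phi> ` ball u0 (r / 2))"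
    using r by (intro op) auto
  moreover have "x \<in> \<phi> ` ball u0 (r / 2)" using u0 r by simp
  ultimately show thesis using that by blast
qed

theorem theorem6:
  fixes \<rho> :: "real^4 \<Rightarrow> real^4 \<Rightarrow> real" and S :: "(real^4) set"
  assumes "homogeneous_distance \<rho>"
    and "C11_surface S"
  shows "spherical_measure \<rho> (surface_degree S) (S - max_degree_points S) = 0"
proof -
  define d where "d = surface_degree S"
  have range: "pointwise_degree S ` S \<subseteq> {2..5}"
    using pointwise_degree_range[OF assms(2)] by blast
  then have fin: "finite (pointwise_degree S ` S)" by (rule finite_subset) simp
  have le: "pointwise_degree S x \<le> d" if "x \<in> S" for x
    unfolding d_def surface_degree_def using fin that by simp
  have low: "S - max_degree_points S = {y \<in> S. pointwise_degree S y < d}"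
    using le unfolding max_degree_points_def d_def[symmetric] by (auto simp: less_le)
  have "spherical_measure \<rho> d {y \<in> S. pointwise_degree S y < d} = 0"
  proof (rule spherical_measure_eq_0_if_locally_small[OF assms(1), where S = S])
    fix x assume x: "x \<in> S"
    show "\<exists>W. openin (top_of_set S) W \<and> x \<in> W \<and> has_small_covers \<rho> d (W \<inter> {y \<in> S. pointwise_degree S y < d})"
    proof (cases "d \<le> 2")
      case True
      then have empty: "{y \<in> S. pointwise_degree S y < d} = {}"
        using range by fastforce
      have "has_small_covers \<rho> d (S \<inter> {y \<in> S. pointwise_degree S y < d})"
        unfolding empty Int_empty_right by (rule has_small_covers_empty)
      with x show ?thesis
        by (intro exI[of _ S]) simp
    next
      case False
      have "d \<in> pointwise_degree S ` S"
        unfolding d_def surface_degree_def using x fin by (intro Max_in) auto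
      then have "d \<in> {3..5}" using False range by force
      then show ?thesis
        by (rule low_degree_points_locally_small[OF assms x]) blast
    qed
  qed auto
  then show ?thesis unfolding low d_def .
qed

end
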